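(* Consider the equivocation-resistant signature (ERS) protocol with one sender and receivers $\mathcal{P}=\{P_1,\dots,P_N\}$ described in the context, used to sign documents of $b_M$ bits, with $b_H$-bit document hashes, $y$-bit keys, and $b'_H$-bit authentication tags. Then the protocol is $\varepsilon_{\rm rep}$-secure against repudiation (non-transferability) with $$\varepsilon_{\rm rep}=\frac{b_M+b_H+y}{2^{b'_H-1}}$$ for coalitions of size $|C|<N/3$. That is, for every coalition $C\subset\{P_1,\dots,P_N\}$ of malicious receivers with $|C|<N/3$, which may collude with the sender, and for any deviation of the actions of $C$ from the honest behaviour, $$\Pr\left[\exists\,P_i,P_j\notin C:\ \mathrm{Ver}_i(Doc_i,Sig_i)\neq \mathrm{Ver}_j(Doc_j,Sig_j)\right]\le \varepsilon_{\rm rep}.$$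
   Context: **Hash families.** A family $\mathcal{F}=\{f:M\to B\}$ with $B=\{0,1\}^{b_H}$ is $\varepsilon$-almost strongly universal$_2$ ($\varepsilon$-ASU$_2$) if, for $f$ uniformly random in $\mathcal{F}$, $\Pr[f(m)=b]=2^{-b_H}$ for all $m\in M$, $b\in B$, and $\Pr[f(m_1)=b_1\wedge f(m_2)=b_2]\le \varepsilon/2^{b_H}$ for all $m_1\ne m_2$ and all $b_1,b_2\in B$. It is $\varepsilon$-almost XOR universal$_2$ ($\varepsilon$-AXU$_2$) if $\Pr[f(m_1)\oplus f(m_2)=b]\le\varepsilon$ for all $m_1\neq m_2$ and all $b$. $\mathcal{F}_{\rm ASU}$ is a $2^{1-b_H}$-ASU$_2$ family from $b_M$-bit strings to $b_H$-bit strings, each of whose functions $f_h$ is uniquely specified by a string $h$ of $y=3b_H+2\sigma$ bits, where $\sigma$ is the smallest number with $b_M\le(b_H+\sigma)(1+2^\sigma)$. **Authenticated channels.** All authenticated channels (including those in the reliable broadcast) are reliable (no message is lost) and implemented by Wegman–Carter authentication with key recycling: the two users share a secret random function $f$ of a family $\mathcal{F}_{\rm AXU}$ with $b'_H$-bit outputs, which is $\varepsilon$-AXU$_2$ with $\varepsilon=b\,2^{1-b'_H}$ for messages of $b$ bits (linear-feedback-shift-register Toeplitz hashing), and each message $m$ is sent with tag $f(m)\oplus k$, with $k$ a fresh secret uniformly random $b'_H$-bit string. Consequently, a modification of a $b$-bit message is accepted as authentic with probability at most $b/2^{b'_H-1}$. Failure to authenticate any message causes the whole protocol to abort for everyone.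 All preshared keys are uniformly random and perfectly secret. Adversaries are computationally unbounded. **Bracha's reliable broadcast (BRB).** Parameters: $N$ parties, at most $t<N/3$ dishonest; the network is asynchronous, messages between honest parties are eventually delivered; all messages are authenticated; a party sending to all also sends to itself. (1) The broadcaster sends (SEND, $m$) to all. (2) Every party: upon receiving (SEND, $m$) from the broadcaster, sends (ECHO, $m$) to all; upon receiving $\lceil (N+t+1)/2\rceil$ messages (ECHO, $m$) and not having sent a READY message, sends (READY, $m$) to all; upon receiving $t+1$ messages (READY, $m$) and not having sent a READY message, sends (READY, $m$) to all; upon receiving $2t+1$ messages (READY, $m$), delivers $m$. A party aborts if a local timeout expires without delivery; the timeouts are such that, with ideal authentication, either all honest parties deliver the same message or all honest parties abort. **ERS protocol.** 1. Distribution: the sender establishes a pairwise secret key $X_i$ of $y$ bits with each receiver $P_i$, $i=1,\dots,N$. 2. Messaging: (2.1) The sender picks $f_h\in\mathcal{F}_{\rm ASU}$ uniformly at random. (2.2) The sender sends $\{Doc,Sig\}$ over a public channel to the designated receiver, say $P_1$, where $Sig=(t\,\|\,\tilde h_s)$ with $t=f_h(Doc)$, $\tilde h_s=h\oplus X_s$, $X_s=\bigoplus_{i=1}^N X_i$. (2.3) $P_1$ broadcasts $\{Doc,Sig\}$ to all of $\mathcal{P}$ with BRB. If BRB aborts, the ERS protocol aborts; otherwise let $\{Doc_i,Sig_i\}$, $Sig_i=(t_i\|\tilde h_i)$, be the pair obtained by $P_i$. (2.4) Each $P_i$, $i\ne1$, sends $X_i$ to $P_1$ over an authenticated channel. (2.5)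 $P_1$ computes the XOR $X_r$ of the received keys and $X_1$, and broadcasts $X_r$ to $\mathcal{P}$ with BRB. If BRB aborts, the ERS protocol aborts; otherwise let $X_{r,i}$ be the string obtained by $P_i$. (2.6) Each $P_i$ computes $h_i=\tilde h_i\oplus X_{r,i}$ and outputs $\mathrm{Ver}_i(Doc_i,Sig_i)=\mathrm{True}$ if $f_{h_i}(Doc_i)=t_i$, $\mathrm{False}$ if $f_{h_i}(Doc_i)\ne t_i$, and $\mathrm{Abort}$ if an abort occurred in step 2.3 or 2.5. *)

theory Defs
  imports "HOL-Probability.Probability"
begin

section \<open>Bit strings and hash families\<close>

type_synonym bits = "bool list"

definition strings :: "nat \<Rightarrow> bits set" where
  "strings n = {bs. length bs = n}"

text \<open>Only used on strings of equal length.\<close>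

definition bxor :: "bits \<Rightarrow> bits \<Rightarrow> bits" where
  "bxor xs ys = map2 (\<noteq>) xs ys"

definition bxor_list :: "nat \<Rightarrow> bits list \<Rightarrow> bits" where
  "bxor_list n xss = foldr bxor xss (replicate n False)"

text \<open>A family is given by a finite set K of keys and a function for each key; a uniformly random
  member of the family is the function of a uniformly random key.\<close>

definition hash_family :: "'k set \<Rightarrow> ('k \<Rightarrow> bits \<Rightarrow> bits) \<Rightarrow> bits set \<Rightarrow> nat \<Rightarrow> bool" where
  "hash_family K f M n \<longleftrightarrow> finite K \<and> K \<noteq> {} \<and> (\<forall>k\<in>K. \<forall>m\<in>M. f k m \<in> strings n)"

definition ASU2 :: "real \<Rightarrow> 'k set \<Rightarrow> ('k \<Rightarrow> bits \<Rightarrow> bits) \<Rightarrow> bits set \<Rightarrow> nat \<Rightarrow> bool" where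
  "ASU2 \<epsilon> K f M n \<longleftrightarrow> hash_family K f M n \<and>
     (\<forall>m\<in>M. \<forall>b\<in>strings n.
        measure_pmf.prob (pmf_of_set K) {k. f k m = b} = 1 / 2 ^ n) \<and>
     (\<forall>m1\<in>M. \<forall>m2\<in>M. m1 \<noteq> m2 \<longrightarrow> (\<forall>b1\<in>strings n. \<forall>b2\<in>strings n.
        measure_pmf.prob (pmf_of_set K) {k. f k m1 = b1 \<and> f k m2 = b2} \<le> \<epsilon> / 2 ^ n))"

definition AXU2 :: "real \<Rightarrow> 'k set \<Rightarrow> ('k \<Rightarrow> bits \<Rightarrow> bits) \<Rightarrow> bits set \<Rightarrow> nat \<Rightarrow> bool" where
  "AXU2 \<epsilon> K f M n \<longleftrightarrow> hash_family K f M n \<and>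
     (\<forall>m1\<in>M. \<forall>m2\<in>M. m1 \<noteq> m2 \<longrightarrow> (\<forall>b\<in>strings n.
        measure_pmf.prob (pmf_of_set K) {k. bxor (f k m1) (f k m2) = b} \<le> \<epsilon>))"


section \<open>Protocol parameters\<close>

record 'k ers =
  rcvs :: nat                          \<comment> \<open>the number N of receivers; receiver i is the number i\<close>
  flt :: nat                           \<comment> \<open>the fault threshold t of the reliable broadcast\<close>
  doc_len :: nat
  hash_len :: nat
  tag_len :: nat
  asu :: "bits \<Rightarrow> bits \<Rightarrow> bits"          \<comment> \<open>document hash, indexed by the string h\<close>
  axu_keys :: "'k set"
  axu :: "'k \<Rightarrow> bits \<Rightarrow> bits"            \<comment> \<open>recycled hash of the message authentication\<close>

definition receivers :: "'k ers \<Rightarrow> nat set" where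
  "receivers P = {1..rcvs P}"

definition sigma :: "'k ers \<Rightarrow> nat" where
  "sigma P = (LEAST s. doc_len P \<le> (hash_len P + s) * (1 + 2 ^ s))"

definition key_len :: "'k ers \<Rightarrow> nat" where
  "key_len P = 3 * hash_len P + 2 * sigma P"


section \<open>Messages\<close>

text \<open>There are two broadcast instances, both with broadcaster 1: one for the pair of document and
  signature, one for the XOR of the keys. A slot names a message that a receiver sends at most once
  to each other receiver. Authentication uses one fresh pad per slot (and ordered pair of users), so
  that a tag is tied to the label of the message (SEND, ECHO, ...), while the string that is hashed
  is the content of the message alone.\<close>

datatype inst = DocSig | RecKey

datatype kind = SEND | ECHO | READY

datatype slot = Brb inst kind | Share

fun inst_len :: "'k ers \<Rightarrow> inst \<Rightarrow> nat" where
  "inst_len P DocSig = doc_len P + hash_len P + key_len P"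
| "inst_len P RecKey = key_len P"

fun slot_len :: "'k ers \<Rightarrow> slot \<Rightarrow> nat" where
  "slot_len P (Brb e k) = inst_len P e"
| "slot_len P Share = key_len P"

fun recipients :: "'k ers \<Rightarrow> slot \<Rightarrow> nat set" where
  "recipients P (Brb e k) = receivers P"
| "recipients P Share = {1}"

text \<open>Source, destination, slot, content and tag.\<close>

datatype packet = Packet nat nat slot bits bits


section \<open>Secrets\<close>

record 'k secrets =
  pairwise :: "nat \<Rightarrow> bits"              \<comment> \<open>the key X i shared by the sender and receiver i\<close>
  pick :: bits                           \<comment> \<open>the string h picked by an honest sender\<close>
  hkey :: "nat set \<Rightarrow> 'k"                \<comment> \<open>hash key shared by the two users in the set\<close>
  pad :: "nat \<times> nat \<times> slot \<Rightarrow> bits"       \<comment> \<open>one-time pads, per source, destination and slot\<close>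

definition secrets_pmf :: "'k ers \<Rightarrow> 'k secrets pmf" where
  "secrets_pmf P =
     map_pmf (\<lambda>(X, h, f, d). \<lparr>pairwise = X, pick = h, hkey = f, pad = d\<rparr>)
       (pair_pmf (Pi_pmf (receivers P) [] (\<lambda>_. pmf_of_set (strings (key_len P))))
       (pair_pmf (pmf_of_set (strings (key_len P)))
       (pair_pmf (Pi_pmf {{i, j} |i j. i \<in> receivers P \<and> j \<in> receivers P} undefined
                    (\<lambda>_. pmf_of_set (axu_keys P)))
                 (Pi_pmf (receivers P \<times> receivers P \<times> UNIV) []
                    (\<lambda>_. pmf_of_set (strings (tag_len P)))))))"

definition tag :: "'k ers \<Rightarrow> 'k secrets \<Rightarrow> nat \<Rightarrow> nat \<Rightarrow> slot \<Rightarrow> bits \<Rightarrow> bits" where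
  "tag P \<omega> i j s m = bxor (axu P (hkey \<omega> {i, j}) m) (pad \<omega> (i, j, s))"

text \<open>Document and signature as formed by an honest sender.\<close>

definition signed :: "'k ers \<Rightarrow> 'k secrets \<Rightarrow> bits \<Rightarrow> bits" where
  "signed P \<omega> doc = doc @ asu P (pick \<omega>) doc @
     bxor (pick \<omega>) (bxor_list (key_len P) (map (pairwise \<omega>) [1..<Suc (rcvs P)]))"


section \<open>Honest receivers\<close>

record party =
  acc :: "(nat \<times> slot \<times> bits) set"       \<comment> \<open>broadcast messages received so far, with their source\<close>
  share :: "nat \<Rightarrow> bits option"          \<comment> \<open>key received from each of the others\<close>
  sent :: "(slot \<times> bits) set"
  dlv :: "inst \<Rightarrow> bits option"           \<comment> \<open>strings delivered by the two broadcasts\<close>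
  aborted :: bool                        \<comment> \<open>a timeout has expired\<close>

definition fresh_party :: party where
  "fresh_party = \<lparr>acc = {}, share = (\<lambda>_. None), sent = {}, dlv = (\<lambda>_. None), aborted = False\<rparr>"

definition emit :: "slot \<Rightarrow> bits \<Rightarrow> party \<Rightarrow> party" where
  "emit s m p = (if \<exists>m'. (s, m') \<in> sent p then p else p\<lparr>sent := insert (s, m) (sent p)\<rparr>)"

definition votes :: "party \<Rightarrow> slot \<Rightarrow> bits \<Rightarrow> nat" where
  "votes p s m = card {i. (i, s, m) \<in> acc p}"

text \<open>Bracha's rules, applied when a message of kind k with content m arrives from i. Messages are
  counted by distinct sources, and only the first SEND of the broadcaster is echoed.\<close>

definition brb_react :: "'k ers \<Rightarrow> nat \<Rightarrow> inst \<Rightarrow> kind \<Rightarrow> bits \<Rightarrow> party \<Rightarrow> party" where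
  "brb_react P i e k m p0 =
     (let p = p0\<lparr>acc := insert (i, Brb e k, m) (acc p0)\<rparr>;
          p1 = (if k = SEND \<and> i = 1 then emit (Brb e ECHO) m p else p);
          p2 = (if votes p (Brb e ECHO) m \<ge> nat \<lceil>(real (rcvs P) + real (flt P) + 1) / 2\<rceil> \<or>
                   votes p (Brb e READY) m \<ge> flt P + 1
                then emit (Brb e READY) m p1 else p1)
      in if votes p (Brb e READY) m \<ge> 2 * flt P + 1 \<and> dlv p2 e = None
         then p2\<lparr>dlv := (dlv p2)(e \<mapsto> m)\<rparr> else p2)"

text \<open>Having delivered document and signature, receiver j sends its key to receiver 1, and receiver
  1 broadcasts the XOR of all keys once it has received them.\<close>

definition key_react :: "'k ers \<Rightarrow> 'k secrets \<Rightarrow> nat \<Rightarrow> party \<Rightarrow> party" where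
  "key_react P \<omega> j p =
     (if dlv p DocSig = None then p
      else if j \<noteq> 1 then emit Share (pairwise \<omega> j) p
      else if \<forall>k\<in>{2..rcvs P}. share p k \<noteq> None
      then emit (Brb RecKey SEND)
             (bxor_list (key_len P) (pairwise \<omega> 1 # map (\<lambda>k. the (share p k)) [2..<Suc (rcvs P)])) p
      else p)"

definition recv ::
  "'k ers \<Rightarrow> 'k secrets \<Rightarrow> nat \<Rightarrow> nat \<Rightarrow> slot \<Rightarrow> bits \<Rightarrow> party \<Rightarrow> party" where
  "recv P \<omega> j i s m p =
     key_react P \<omega> j
       (case s of
          Brb e k \<Rightarrow> brb_react P i e k m p
        | Share \<Rightarrow> (if share p i = None then p\<lparr>share := (share p)(i \<mapsto> m)\<rparr> else p))"


section \<open>Executions\<close>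

text \<open>The adversary controls the receivers in C, the public channel and the (asynchronous) network,
  and chooses when timeouts expire. Deliver hands a packet, possibly modified or made up, to its
  destination; Input hands a string to receiver 1 as the message of the sender; Timeout lets the
  timeout of a receiver for a broadcast expire.\<close>

datatype action = Deliver packet | Input bits | Timeout nat inst

type_synonym history = "(action \<times> packet set) list"  \<comment> \<open>actions, with the packets sent in response\<close>

record state =
  parties :: "nat \<Rightarrow> party"              \<comment> \<open>relevant for receivers outside C only\<close>
  hist :: history
  failed :: bool                         \<comment> \<open>a message failed to authenticate: everyone aborts\<close>
  forged :: bool                         \<comment> \<open>a packet was accepted that its honest source did not send\<close>

definition wire :: "state \<Rightarrow> packet set" where
  "wire \<sigma> = (\<Union>(a, Q)\<in>set (hist \<sigma>). Q)"

definition init :: state where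
  "init = \<lparr>parties = (\<lambda>_. fresh_party), hist = [], failed = False, forged = False\<rparr>"

text \<open>Record action a, and let receiver j move to local state p.\<close>

definition update :: "'k ers \<Rightarrow> 'k secrets \<Rightarrow> action \<Rightarrow> nat \<Rightarrow> party \<Rightarrow> state \<Rightarrow> state" where
  "update P \<omega> a j p \<sigma> = \<sigma>\<lparr>
     parties := (parties \<sigma>)(j := p),
     hist := hist \<sigma> @ [(a, {Packet j k s m (tag P \<omega> j k s m) |k s m.
                             (s, m) \<in> sent p - sent (parties \<sigma> j) \<and> k \<in> recipients P s})]\<rparr>"

definition active :: "'k ers \<Rightarrow> nat set \<Rightarrow> state \<Rightarrow> nat \<Rightarrow> bool" where
  "active P C \<sigma> j \<longleftrightarrow> j \<in> receivers P - C \<and> \<not> aborted (parties \<sigma> j)"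

text \<open>The message of a receiver to itself uses no channel, so nothing else can be delivered in its
  place. Dishonest receivers know the keys they share, so they can send any number of messages of
  any kind; the acceptance test is the same for them.\<close>

fun step :: "'k ers \<Rightarrow> 'k secrets \<Rightarrow> nat set \<Rightarrow> action \<Rightarrow> state \<Rightarrow> state" where
  "step P \<omega> C (Deliver (Packet i j s m \<tau>)) \<sigma> =
     (let a = Deliver (Packet i j s m \<tau>);
          genuine = (Packet i j s m \<tau> \<in> wire \<sigma>);
          p = parties \<sigma> j
      in if failed \<sigma> \<or> i \<notin> receivers P \<or> \<not> active P C \<sigma> j \<or> (i = j \<and> \<not> genuine)
         then update P \<omega> a j p \<sigma>
         else if length m = slot_len P s \<and> \<tau> = tag P \<omega> i j s m
         then (update P \<omega> a j (recv P \<omega> j i s m p) \<sigma>)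
                \<lparr>forged := (forged \<sigma> \<or> (i \<notin> C \<and> \<not> genuine))\<rparr>
         else (update P \<omega> a j p \<sigma>)\<lparr>failed := True\<rparr>)"
| "step P \<omega> C (Input m) \<sigma> =
     (let p = parties \<sigma> 1
      in update P \<omega> (Input m) 1
           (if \<not> failed \<sigma> \<and> active P C \<sigma> 1 \<and> length m = inst_len P DocSig
            then emit (Brb DocSig SEND) m p else p) \<sigma>)"
| "step P \<omega> C (Timeout j e) \<sigma> =
     (let p = parties \<sigma> j
      in update P \<omega> (Timeout j e) j
           (if \<not> failed \<sigma> \<and> active P C \<sigma> j \<and> dlv p e = None
            then p\<lparr>aborted := True\<rparr> else p) \<sigma>)"

text \<open>Initial knowledge of the adversary: the secrets of the receivers in C, and either all pairwise
  keys, if the sender colludes, or the message sent over the public channel by an honest sender.\<close>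

record 'k knowledge =
  kn_pairwise :: "nat \<Rightarrow> bits option"
  kn_hkey :: "nat set \<Rightarrow> 'k option"
  kn_pad :: "nat \<times> nat \<times> slot \<Rightarrow> bits option"
  kn_signed :: "bits option"

definition knowledge :: "'k ers \<Rightarrow> 'k secrets \<Rightarrow> nat set \<Rightarrow> bool \<Rightarrow> bits \<Rightarrow> 'k knowledge" where
  "knowledge P \<omega> C colluding doc = \<lparr>
     kn_pairwise = (\<lambda>i. if colluding \<or> i \<in> C then Some (pairwise \<omega> i) else None),
     kn_hkey = (\<lambda>U. if U \<inter> C \<noteq> {} then Some (hkey \<omega> U) else None),
     kn_pad = (\<lambda>(i, j, s). if i \<in> C \<or> j \<in> C then Some (pad \<omega> (i, j, s)) else None),
     kn_signed = (if colluding then None else Some (signed P \<omega> doc))\<rparr>"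

text \<open>A strategy takes the random coins of the adversary as first argument and is otherwise
  arbitrary.\<close>

type_synonym ('r, 'k) strategy = "'r \<Rightarrow> 'k knowledge \<Rightarrow> history \<Rightarrow> action"

fun run ::
  "'k ers \<Rightarrow> 'k secrets \<Rightarrow> nat set \<Rightarrow> ('k knowledge \<Rightarrow> history \<Rightarrow> action) \<Rightarrow> 'k knowledge \<Rightarrow> nat \<Rightarrow> state"
  where
  "run P \<omega> C A kn 0 = init"
| "run P \<omega> C A kn (Suc n) =
     (let \<sigma> = run P \<omega> C A kn n in step P \<omega> C (A kn (hist \<sigma>)) \<sigma>)"

text \<open>The final state of a run of T actions.\<close>

definition execution ::
  "'k ers \<Rightarrow> nat set \<Rightarrow> bool \<Rightarrow> bits \<Rightarrow> 'r pmf \<Rightarrow> ('r, 'k) strategy \<Rightarrow> nat \<Rightarrow> state pmf" where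
  "execution P C colluding doc R A T =
     map_pmf (\<lambda>(\<omega>, r). run P \<omega> C (A r) (knowledge P \<omega> C colluding doc) T)
       (pair_pmf (secrets_pmf P) R)"

text \<open>The requirement on timeouts: with ideal authentication, in each broadcast all honest receivers
  deliver or all honest receivers abort. A receiver that has not delivered at the end of the run has
  aborted. That the delivered strings agree is not required here.\<close>

definition timeouts_ok :: "'k ers \<Rightarrow> nat set \<Rightarrow> state pmf \<Rightarrow> bool" where
  "timeouts_ok P C E \<longleftrightarrow>
     (\<forall>\<sigma>\<in>set_pmf E. \<not> failed \<sigma> \<and> \<not> forged \<sigma> \<longrightarrow>
        (\<forall>e. (\<forall>i\<in>receivers P - C. dlv (parties \<sigma> i) e \<noteq> None) \<or>
             (\<forall>i\<in>receivers P - C. dlv (parties \<sigma> i) e = None)))"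


section \<open>Verification\<close>

datatype verdict = VTrue | VFalse | VAbort

definition verdict :: "'k ers \<Rightarrow> state \<Rightarrow> nat \<Rightarrow> verdict" where
  "verdict P \<sigma> i =
     (if failed \<sigma> then VAbort
      else case (dlv (parties \<sigma> i) DocSig, dlv (parties \<sigma> i) RecKey) of
        (Some ds, Some x) \<Rightarrow>
          (let doc = take (doc_len P) ds;
               t = take (hash_len P) (drop (doc_len P) ds);
               h = bxor (drop (doc_len P + hash_len P) ds) x
           in if asu P h doc = t then VTrue else VFalse)
      | _ \<Rightarrow> VAbort)"

definition repudiated :: "'k ers \<Rightarrow> nat set \<Rightarrow> state \<Rightarrow> bool" where
  "repudiated P C \<sigma> \<longleftrightarrow>
     (\<exists>i\<in>receivers P - C. \<exists>j\<in>receivers P - C. verdict P \<sigma> i \<noteq> verdict P \<sigma> j)"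

end

theory Submission
  imports Defs
begin

text \<open>As long as no packet is forged, Bracha's quorum argument shows that all honest receivers deliver
  the same strings, hence reach the same verdict; and once a packet fails to authenticate everybody
  aborts. So repudiation requires that the first attempt to forge a packet between two honest
  receivers succeeds.

  To bound the probability of this, the one-time pads are traded for the tags they mask. A slot that
  is still unused at the time of the attempt is treated as if it had carried an arbitrary string
  different from the forged one. Given the tags and the secrets of the coalition, the run up to the
  attempt is determined, so the hash key of the attacked pair is still uniform, and the attempt
  succeeds only if the hashes of two fixed distinct strings have a prescribed XOR. No union bound over
  pairs of receivers or attempts is needed, since only the first attempt counts.\<close>


section \<open>Conditioning and changing variables in product distributions\<close>

text \<open>The obstacle is adaptivity: which string a pad masks depends on the tags seen so far,
  hence on the hash keys and the pads themselves, so no change of variables fixed in advance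
  applies. It is therefore defined only on secrets that lead to a breach, as a relation between the
  pads and the tags at the state of the breach. Since pads are uniform, injectivity for fixed hash
  keys suffices. It holds because the tags already determine the run up to the breach, hence the
  masked strings, hence the pads. The same determinacy, now with the hash keys of the pairs avoiding
  C left free, makes the AXU property applicable: the tag of the forged string and the tag of the
  string covering its slot share one pad, and both are fixed. The numerator of the bound is the
  length of the longest authenticated content, document with signature.\<close>

lemma emeasure_pair_pmf:
  "emeasure (pair_pmf p q) E = (\<integral>\<^sup>+x. emeasure q {y. (x, y) \<in> E} \<partial>p)"
proof -
  have "pair_pmf p q = bind_pmf p (\<lambda>x. map_pmf (Pair x) q)"
    by (simp add: pair_pmf_def map_pmf_def)
  then show ?thesis
    by (simp add: vimage_def)
qed

lemma prob_pair_pmf_le: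
  assumes "\<And>x. x \<in> set_pmf p \<Longrightarrow> measure_pmf.prob q {y. (x, y) \<in> E} \<le> c" and "0 \<le> c"
  shows "measure_pmf.prob (pair_pmf p q) E \<le> c"
proof -
  have "emeasure (pair_pmf p q) E = (\<integral>\<^sup>+x. emeasure q {y. (x, y) \<in> E} \<partial>p)"
    by (rule emeasure_pair_pmf)
  also have "\<dots> \<le> (\<integral>\<^sup>+x. ennreal c \<partial>p)"
    by (intro nn_integral_mono_AE)
       (auto simp: AE_measure_pmf_iff measure_pmf.emeasure_eq_measure assms intro!: ennreal_leI)
  also have "\<dots> = ennreal c"
    by simp
  finally show ?thesis
    using assms(2) by (simp add: measure_pmf.emeasure_eq_measure)
qed

lemma prob_pair_pmf_le':
  assumes "\<And>y. y \<in> set_pmf q \<Longrightarrow> measure_pmf.prob p {x. (x, y) \<in> E} \<le> c" and "0 \<le> c"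
  shows "measure_pmf.prob (pair_pmf p q) E \<le> c"
proof -
  have "measure_pmf.prob (pair_pmf p q) E = measure_pmf.prob (pair_pmf q p) {(y, x). (x, y) \<in> E}"
    by (subst pair_commute_pmf) (auto intro!: arg_cong[where f = "measure_pmf.prob _"])
  also have "\<dots> \<le> c"
    using assms by (intro prob_pair_pmf_le) auto
  finally show ?thesis .
qed

text \<open>For fixed x, the relation Psi maps the part of D that lies in the event injectively into D, so
  the uniform element of D may be exchanged for its image, which is then fixed first.\<close>

lemma prob_pair_pmf_of_set_le:
  assumes "finite D" and "D \<noteq> {}" and "0 \<le> c"
    and total: "\<And>x y. x \<in> set_pmf p \<Longrightarrow> y \<in> D \<Longrightarrow> (x, y) \<in> E \<Longrightarrow> \<exists>z\<in>D. \<Psi> x y z"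
    and inj: "\<And>x y y' z. \<Psi> x y z \<Longrightarrow> \<Psi> x y' z \<Longrightarrow> y = y'"
    and bound: "\<And>z. z \<in> D \<Longrightarrow> measure_pmf.prob p {x. \<exists>y. \<Psi> x y z} \<le> c"
  shows "measure_pmf.prob (pair_pmf p (pmf_of_set D)) E \<le> c"
proof -
  define E' where "E' = {(x, z). \<exists>y. \<Psi> x y z}"
  let ?q = "pmf_of_set D"
  have fibre: "measure_pmf.prob ?q {y. (x, y) \<in> E} \<le> measure_pmf.prob ?q {z. (x, z) \<in> E'}"
    if x: "x \<in> set_pmf p" for x
  proof -
    have "\<exists>g. \<forall>y\<in>D \<inter> {y. (x, y) \<in> E}. g y \<in> D \<and> \<Psi> x y (g y)"
      using total[OF x] by (intro bchoice) auto
    then obtain g where g: "\<And>y. y \<in> D \<Longrightarrow> (x, y) \<in> E \<Longrightarrow> g y \<in> D \<and> \<Psi> x y (g y)"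
      by auto
    have "inj_on g (D \<inter> {y. (x, y) \<in> E})"
      using g inj by (intro inj_onI) (metis IntE mem_Collect_eq)
    moreover have "g ` (D \<inter> {y. (x, y) \<in> E}) \<subseteq> D \<inter> {z. (x, z) \<in> E'}"
      using g by (auto simp: E'_def)
    ultimately have "card (D \<inter> {y. (x, y) \<in> E}) \<le> card (D \<inter> {z. (x, z) \<in> E'})"
      using \<open>finite D\<close> by (meson card_inj_on_le finite_Int)
    then show ?thesis
      using \<open>finite D\<close> \<open>D \<noteq> {}\<close> by (simp add: measure_pmf_of_set divide_right_mono)
  qed
  have "emeasure (pair_pmf p ?q) E \<le> emeasure (pair_pmf p ?q) E'"
    unfolding emeasure_pair_pmf using fibre
    by (intro nn_integral_mono_AE)
       (auto simp: AE_measure_pmf_iff measure_pmf.emeasure_eq_measure intro!: ennreal_leI)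
  then have "measure_pmf.prob (pair_pmf p ?q) E \<le> measure_pmf.prob (pair_pmf p ?q) E'"
    by (simp add: measure_pmf.emeasure_eq_measure)
  \<comment> \<open>Here the roles are swapped: the image z is fixed and the first coordinate stays
    random.\<close>
  also have "\<dots> \<le> c"
    using assms(1-3) bound by (intro prob_pair_pmf_le') (auto simp: E'_def)
  finally show ?thesis .
qed

text \<open>The coordinate x and its bad set K may depend on f, but only through the coordinates in B.\<close>

lemma prob_Pi_pmf_le_component:
  assumes "finite A" and "B \<subseteq> A" and "0 \<le> c"
    and comp: "\<And>f. f \<in> E \<Longrightarrow> \<exists>x\<in>A - B. \<exists>K. measure_pmf.prob (p x) K \<le> c \<and>
                  (\<forall>f'\<in>E. (\<forall>y\<in>B. f' y = f y) \<longrightarrow> f' x \<in> K)"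
  shows "measure_pmf.prob (Pi_pmf A d p) E \<le> c"
proof -
  have fin: "finite B" "finite (A - B)"
    using assms by (auto intro: finite_subset)
  define j where "j = (\<lambda>(f, g) x. if x \<in> B then f x else g x :: 'b)"
  have "measure_pmf.prob (pair_pmf (Pi_pmf B d p) (Pi_pmf (A - B) d p)) (j -` E) \<le> c"
  proof (rule prob_pair_pmf_le)
    fix f
    show "measure_pmf.prob (Pi_pmf (A - B) d p) {g. (f, g) \<in> j -` E} \<le> c"
    proof (cases "\<exists>g. j (f, g) \<in> E")
      case True
      \<comment> \<open>One completion g of the fixed part f supplies x and K; every other
        completion in E agrees with it on B and so lands in the same K.\<close>
      then obtain g where g: "j (f, g) \<in> E"
        by blast
      from comp[OF this] obtain x K where x: "x \<in> A - B" and K: "measure_pmf.prob (p x) K \<le> c"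
        and *: "\<And>f'. f' \<in> E \<Longrightarrow> (\<forall>y\<in>B. f' y = j (f, g) y) \<Longrightarrow> f' x \<in> K"
        by blast
      have "measure_pmf.prob (Pi_pmf (A - B) d p) {g. (f, g) \<in> j -` E}
              \<le> measure_pmf.prob (Pi_pmf (A - B) d p) ((\<lambda>g. g x) -` K)"
        using *[of "j (f, _)"] x by (intro measure_pmf.finite_measure_mono) (auto simp: j_def)
      also have "\<dots> = measure_pmf.prob (map_pmf (\<lambda>g. g x) (Pi_pmf (A - B) d p)) K"
        by simp
      also have "\<dots> \<le> c"
        using x K fin by (simp add: Pi_pmf_component del: measure_map_pmf)
      finally show ?thesis .
    qed (use \<open>0 \<le> c\<close> in simp)
  qed fact
  moreover have "Pi_pmf A d p = map_pmf j (pair_pmf (Pi_pmf B d p) (Pi_pmf (A - B) d p))"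
    unfolding j_def using Pi_pmf_union[OF fin, of d p] \<open>B \<subseteq> A\<close> by (simp add: Un_absorb1)
  ultimately show ?thesis
    by simp
qed


section \<open>Local behaviour of honest receivers\<close>

abbreviation honest :: "'k ers \<Rightarrow> nat set \<Rightarrow> nat set" where
  "honest P C \<equiv> receivers P - C"

text \<open>One content per slot serves twice: an honest receiver cannot echo two strings, and no
  pad masks two of them. The clause on \<open>share\<close> ensures that the XOR of the received
  keys has the length of its slot.\<close>

definition sends_well_formed :: "'k ers \<Rightarrow> party \<Rightarrow> bool" where
  "sends_well_formed P p \<longleftrightarrow>
     (\<forall>s m. (s, m) \<in> sent p \<longrightarrow> length m = slot_len P s) \<and>
     (\<forall>s m m'. (s, m) \<in> sent p \<longrightarrow> (s, m') \<in> sent p \<longrightarrow> m = m') \<and>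
     (\<forall>i m. share p i = Some m \<longrightarrow> length m = key_len P)"

section \<open>XOR of bit strings\<close>

lemma length_bxor [simp]: "length (bxor xs ys) = min (length xs) (length ys)"
  by (simp add: bxor_def)

lemma nth_bxor: "n < length xs \<Longrightarrow> n < length ys \<Longrightarrow> bxor xs ys ! n = (xs ! n \<noteq> ys ! n)"
  by (simp add: bxor_def)

text \<open>With xs a hash and ys a pad, this recovers the pad from the tag.\<close>

lemma bxor_cancel_left:
  assumes "length xs = length ys" and "length xs = length ys'"
  shows "bxor xs ys = bxor xs ys' \<longleftrightarrow> ys = ys'"
  using assms by (auto simp: list_eq_iff_nth_eq nth_bxor)

text \<open>Two tags under one pad expose the XOR of the two hashes, the quantity that the AXU
  property bounds.\<close>

lemma bxor_bxor_cancel: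
  assumes "length xs = length zs" and "length ys = length zs"
  shows "bxor (bxor xs zs) (bxor ys zs) = bxor xs ys"
  using assms by (auto simp: list_eq_iff_nth_eq nth_bxor)

lemma length_bxor_list: "\<forall>xs\<in>set xss. length xs = n \<Longrightarrow> length (bxor_list n xss) = n"
  by (induction xss) (auto simp: bxor_list_def)

section \<open>Sending by honest receivers\<close>

lemma emit_simps [simp]:
  "acc (emit s m p) = acc p" "share (emit s m p) = share p" "dlv (emit s m p) = dlv p"
  "aborted (emit s m p) = aborted p"
  by (simp_all add: emit_def)

lemma votes_emit [simp]: "votes (emit s m p) = votes p"
  by (simp add: votes_def fun_eq_iff)

lemma sent_emit_subset: "sent p \<subseteq> sent (emit s m p)"
  by (auto simp: emit_def)

lemma sent_emit_mono: "x \<in> sent p \<Longrightarrow> x \<in> sent (emit s m p)"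
  using sent_emit_subset by blast

lemma sent_emitD: "(s', m') \<in> sent (emit s m p) \<Longrightarrow> (s', m') \<in> sent p \<or> s' = s \<and> m' = m"
  by (auto simp: emit_def split: if_splits)

lemma sends_well_formed_cong:
  "sent p = sent q \<Longrightarrow> share p = share q \<Longrightarrow> sends_well_formed P p = sends_well_formed P q"
  by (simp add: sends_well_formed_def)

lemma sends_well_formed_emit:
  "sends_well_formed P p \<Longrightarrow> length m = slot_len P s \<Longrightarrow> sends_well_formed P (emit s m p)"
  unfolding sends_well_formed_def emit_def by auto

lemma sends_well_formed_brb_react:
  assumes "sends_well_formed P p" and "length m = inst_len P e"
  shows "sends_well_formed P (brb_react P i e k m p)"
proof -
  have upd: "sends_well_formed P (p\<lparr>acc := a\<rparr>) = sends_well_formed P p"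
    "sends_well_formed P (p\<lparr>dlv := d\<rparr>) = sends_well_formed P p" for p :: party and a d
    by (simp_all add: sends_well_formed_def)
  show ?thesis
    using assms by (simp add: brb_react_def Let_def upd sends_well_formed_emit)
qed

lemma sends_well_formed_key_react:
  assumes "sends_well_formed P p" and "\<forall>k\<in>receivers P. length (pairwise \<omega> k) = key_len P"
    and "j \<in> receivers P"
  shows "sends_well_formed P (key_react P \<omega> j p)"
proof (cases "dlv p DocSig \<noteq> None \<and> j = 1 \<and> (\<forall>k\<in>{2..rcvs P}. share p k \<noteq> None)")
  case True
  then have "\<forall>k\<in>{2..rcvs P}. length (the (share p k)) = key_len P"
    using assms(1) by (fastforce simp: sends_well_formed_def)
  then have "length (bxor_list (key_len P)
      (pairwise \<omega> 1 # map (\<lambda>k. the (share p k)) [2..<Suc (rcvs P)])) = key_len P"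
    using assms True by (intro length_bxor_list) auto
  then show ?thesis
    using True assms by (simp add: key_react_def sends_well_formed_emit)
next
  case False
  then show ?thesis
    using assms by (auto simp: key_react_def intro: sends_well_formed_emit)
qed

lemma sends_well_formed_recv:
  assumes "sends_well_formed P p" and "\<forall>k\<in>receivers P. length (pairwise \<omega> k) = key_len P"
    and "j \<in> receivers P" and "length m = slot_len P s"
  shows "sends_well_formed P (recv P \<omega> j i s m p)"
proof -
  have "sends_well_formed P (case s of Brb e k \<Rightarrow> brb_react P i e k m p
      | Share \<Rightarrow> (if share p i = None then p\<lparr>share := (share p)(i \<mapsto> m)\<rparr> else p))"
    using assms by (auto split: slot.split simp: sends_well_formed_brb_react)
      (auto simp: sends_well_formed_def)
  then show ?thesis
    unfolding recv_def using assms by (intro sends_well_formed_key_react)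
qed

section \<open>Bracha's rules: the votes behind a READY message or a delivery\<close>

definition echo_quorum :: "'k ers \<Rightarrow> nat" where
  "echo_quorum P = nat \<lceil>(real (rcvs P) + real (flt P) + 1) / 2\<rceil>"

text \<open>The nested lets become named intermediate states. Votes are counted in p0, and since the
  later stages leave \<open>acc\<close> alone, these are also the counts of the resulting
  state.\<close>

lemma brb_react_stages:
  obtains p0 p1 p2 where "p0 = p\<lparr>acc := insert (i, Brb e k, m) (acc p)\<rparr>"
    and "p1 = (if k = SEND \<and> i = 1 then emit (Brb e ECHO) m p0 else p0)"
    and "p2 = (if echo_quorum P \<le> votes p0 (Brb e ECHO) m \<or> flt P + 1 \<le> votes p0 (Brb e READY) m
               then emit (Brb e READY) m p1 else p1)"
    and "brb_react P i e k m p =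
      (if 2 * flt P + 1 \<le> votes p0 (Brb e READY) m \<and> dlv p2 e = None
       then p2\<lparr>dlv := (dlv p2)(e \<mapsto> m)\<rparr> else p2)"
  unfolding brb_react_def Let_def echo_quorum_def by blast

lemma sent_brb_react_mono: "sent p \<subseteq> sent (brb_react P i e k m p)"
proof (rule brb_react_stages[where p = p and i = i and e = e and k = k and m = m and P = P], goal_cases)
  case (1 p0 p1 p2)
  note p0 = 1(1) and p1 = 1(2) and p2 = 1(3) and react = 1(4)
  have "sent p \<subseteq> sent p0"
    by (simp add: p0)
  also have "\<dots> \<subseteq> sent p1"
    by (simp add: p1 sent_emit_subset)
  also have "\<dots> \<subseteq> sent p2"
    by (simp add: p2 sent_emit_subset)
  also have "\<dots> \<subseteq> sent (brb_react P i e k m p)"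
    by (simp add: react)
  finally show ?thesis .
qed

lemma acc_brb_react [simp]: "acc (brb_react P i e k m p) = insert (i, Brb e k, m) (acc p)"
proof (rule brb_react_stages[where p = p and i = i and e = e and k = k and m = m and P = P], goal_cases)
  case (1 p0 p1 p2)
  note p0 = 1(1) and p1 = 1(2) and p2 = 1(3) and react = 1(4)
  have "acc (brb_react P i e k m p) = acc p2"
    by (simp add: react)
  also have "\<dots> = acc p1"
    by (simp add: p2)
  also have "\<dots> = acc p0"
    by (simp add: p1)
  finally show ?thesis
    by (simp add: p0)
qed

lemma votes_cong: "acc p = acc q \<Longrightarrow> votes p = votes q"
  by (simp add: votes_def fun_eq_iff)

text \<open>The counts refer to the state after the reaction because the arriving message may itself
  complete the quorum.\<close>

lemma ready_brb_reactD:
  assumes "(Brb e' READY, m') \<in> sent (brb_react P i e k m p)"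
  shows "(Brb e' READY, m') \<in> sent p \<or>
    echo_quorum P \<le> votes (brb_react P i e k m p) (Brb e' ECHO) m' \<or>
    flt P + 1 \<le> votes (brb_react P i e k m p) (Brb e' READY) m'"
proof (rule brb_react_stages[where p = p and i = i and e = e and k = k and m = m and P = P], goal_cases)
  case (1 p0 p1 p2)
  note p0 = 1(1) and p1 = 1(2) and p2 = 1(3) and react = 1(4)
  have votes_eq: "votes (brb_react P i e k m p) = votes p0"
    by (rule votes_cong) (simp add: p0)
  have "sent (brb_react P i e k m p) = sent p2"
    by (simp add: react)
  with assms have "(Brb e' READY, m') \<in> sent p2"
    by simp
  then have "(Brb e' READY, m') \<in> sent p1 \<or>
      e' = e \<and> m' = m \<and> (echo_quorum P \<le> votes p0 (Brb e ECHO) m \<or> flt P + 1 \<le> votes p0 (Brb e READY) m)"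
    unfolding p2 by (simp split: if_splits) (blast dest: sent_emitD)
  moreover have "(Brb e' READY, m') \<in> sent p" if "(Brb e' READY, m') \<in> sent p1"
  proof -
    from that have "(Brb e' READY, m') \<in> sent p0"
      unfolding p1 by (auto dest: sent_emitD split: if_splits)
    then show ?thesis
      by (simp add: p0)
  qed
  ultimately show ?thesis
    unfolding votes_eq by blast
qed

lemma dlv_brb_reactD:
  assumes "dlv (brb_react P i e k m p) e' = Some m'"
  shows "dlv p e' = Some m' \<or> 2 * flt P + 1 \<le> votes (brb_react P i e k m p) (Brb e' READY) m'"
proof (rule brb_react_stages[where p = p and i = i and e = e and k = k and m = m and P = P], goal_cases)
  case (1 p0 p1 p2)
  note p0 = 1(1) and p1 = 1(2) and p2 = 1(3) and react = 1(4)
  have votes_eq: "votes (brb_react P i e k m p) = votes p0"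
    by (rule votes_cong) (simp add: p0)
  have "dlv p2 = dlv p1"
    by (simp add: p2)
  also have "\<dots> = dlv p0"
    by (simp add: p1)
  also have "\<dots> = dlv p"
    by (simp add: p0)
  finally have "dlv p2 = dlv p" .
  with assms show ?thesis
    unfolding votes_eq unfolding react by (auto split: if_splits)
qed

text \<open>Only \<open>Share\<close> and the SEND of \<open>RecKey\<close> are ever emitted here,
  so the key exchange is invisible to the arguments about READY messages and deliveries.\<close>

lemma key_react_cases:
  obtains "key_react P \<omega> j p = p" | m where "key_react P \<omega> j p = emit Share m p"
  | m where "key_react P \<omega> j p = emit (Brb RecKey SEND) m p"
  unfolding key_react_def by metis

lemma key_react_simps [simp]:
  "acc (key_react P \<omega> j p) = acc p" "dlv (key_react P \<omega> j p) = dlv p"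
  "votes (key_react P \<omega> j p) = votes p"
  by (cases rule: key_react_cases[of P \<omega> j p]; simp)+

lemma sent_key_react_mono: "sent p \<subseteq> sent (key_react P \<omega> j p)"
  by (cases rule: key_react_cases[of P \<omega> j p]) (simp_all add: sent_emit_subset)

lemma sent_key_reactD:
  "(Brb e READY, m) \<in> sent (key_react P \<omega> j p) \<Longrightarrow> (Brb e READY, m) \<in> sent p"
  by (cases rule: key_react_cases[of P \<omega> j p]) (auto dest: sent_emitD)

lemma recv_Brb: "recv P \<omega> j i (Brb e k) m p = key_react P \<omega> j (brb_react P i e k m p)"
  by (simp add: recv_def)

lemma recv_Share:
  "recv P \<omega> j i Share m p =
     key_react P \<omega> j (if share p i = None then p\<lparr>share := (share p)(i \<mapsto> m)\<rparr> else p)"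
  by (simp add: recv_def)

lemma sent_recv_mono: "sent p \<subseteq> sent (recv P \<omega> j i s m p)"
proof (cases s)
  case (Brb e k)
  then show ?thesis
    unfolding Brb recv_Brb by (intro subset_trans[OF sent_brb_react_mono sent_key_react_mono])
next
  case Share
  have "sent p = sent (if share p i = None then p\<lparr>share := (share p)(i \<mapsto> m)\<rparr> else p)"
    by simp
  then show ?thesis
    unfolding Share recv_Share using sent_key_react_mono by metis
qed

lemma acc_recv:
  "acc (recv P \<omega> j i s m p) = (case s of Share \<Rightarrow> acc p | _ \<Rightarrow> insert (i, s, m) (acc p))"
  by (cases s) (simp_all add: recv_Brb recv_Share)

lemma ready_recvD:
  assumes "(Brb e READY, m') \<in> sent (recv P \<omega> j i s m p)"
  shows "(Brb e READY, m') \<in> sent p \<or>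
    echo_quorum P \<le> votes (recv P \<omega> j i s m p) (Brb e ECHO) m' \<or>
    flt P + 1 \<le> votes (recv P \<omega> j i s m p) (Brb e READY) m'"
proof (cases s)
  case (Brb e k)
  with assms show ?thesis
    using ready_brb_reactD by (simp only: recv_Brb key_react_simps) (blast dest: sent_key_reactD)
next
  case Share
  with assms show ?thesis
    by (auto simp: recv_Share dest!: sent_key_reactD split: if_splits)
qed

lemma dlv_recvD:
  assumes "dlv (recv P \<omega> j i s m p) e = Some m'"
  shows "dlv p e = Some m' \<or> 2 * flt P + 1 \<le> votes (recv P \<omega> j i s m p) (Brb e READY) m'"
proof (cases s)
  case (Brb e k)
  with assms show ?thesis
    using dlv_brb_reactD by (simp only: recv_Brb key_react_simps) blast
next
  case Share
  with assms show ?thesis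
    by (auto simp: recv_Share split: if_splits)
qed


section \<open>State transitions\<close>

lemma update_simps [simp]:
  "parties (update P \<omega> a j p \<sigma>) = (parties \<sigma>)(j := p)"
  "failed (update P \<omega> a j p \<sigma>) = failed \<sigma>" "forged (update P \<omega> a j p \<sigma>) = forged \<sigma>"
  by (simp_all add: update_def)

lemma wire_simps [simp]: "wire (\<sigma>\<lparr>failed := b\<rparr>) = wire \<sigma>" "wire (\<sigma>\<lparr>forged := b\<rparr>) = wire \<sigma>"
  by (simp_all add: wire_def)

text \<open>The wire recomputed from local states and secrets. If one state satisfies
  \<open>wire \<sigma> = packets P \<omega> (parties \<sigma>)\<close> for two choices of secrets,
  every tag on its wire is genuine under both.\<close>

definition packets :: "'k ers \<Rightarrow> 'k secrets \<Rightarrow> (nat \<Rightarrow> party) \<Rightarrow> packet set" where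
  "packets P \<omega> ps = {Packet j k s m (tag P \<omega> j k s m) |j k s m.
                       (s, m) \<in> sent (ps j) \<and> k \<in> recipients P s}"

text \<open>The history stores packets only for new entries of \<open>sent\<close>; nothing is lost
  as long as \<open>sent\<close> does not shrink.\<close>

lemma wire_update:
  assumes "wire \<sigma> = packets P \<omega> (parties \<sigma>)" and "sent (parties \<sigma> j) \<subseteq> sent p"
  shows "wire (update P \<omega> a j p \<sigma>) = packets P \<omega> ((parties \<sigma>)(j := p))"
proof -
  define ps where "ps = (parties \<sigma>)(j := p)"
  have ps: "ps j = p" "i \<noteq> j \<Longrightarrow> ps i = parties \<sigma> i" for i
    by (simp_all add: ps_def)
  have sub: "sent (parties \<sigma> i) \<subseteq> sent (ps i)" for i
    using assms(2) by (simp add: ps_def)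
  let ?new = "{Packet j k s m (tag P \<omega> j k s m) |k s m.
                             (s, m) \<in> sent p - sent (parties \<sigma> j) \<and> k \<in> recipients P s}"
  have "wire (update P \<omega> a j p \<sigma>) = packets P \<omega> (parties \<sigma>) \<union> ?new"
    unfolding assms(1)[symmetric] by (auto simp: wire_def update_def)
  moreover have "packets P \<omega> (parties \<sigma>) \<union> ?new \<subseteq> packets P \<omega> ps"
    unfolding packets_def using sub ps(1) by blast
  moreover have "packets P \<omega> ps \<subseteq> packets P \<omega> (parties \<sigma>) \<union> ?new"
    unfolding packets_def using ps by (smt (verit) DiffI UnCI mem_Collect_eq subsetI)
  ultimately show ?thesis
    unfolding ps_def[symmetric] by (metis subset_antisym)
qed

text \<open>Rejected packets, ignored deliveries and ineffective inputs or timeouts leave all local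
  states alone and at most raise \<open>failed\<close>, so a single case covers them and each
  invariant has only four cases to check.\<close>

lemma step_cases [consumes 0, case_names idle deliver input timeout]:
  obtains (idle) j fl where "step P \<omega> C a \<sigma> = (update P \<omega> a j (parties \<sigma> j) \<sigma>)\<lparr>failed := fl\<rparr>"
      "failed \<sigma> \<Longrightarrow> fl"
  | (deliver) i j s m \<tau> where "a = Deliver (Packet i j s m \<tau>)" "active P C \<sigma> j"
      "i \<in> receivers P" "i = j \<Longrightarrow> Packet i j s m \<tau> \<in> wire \<sigma>" "length m = slot_len P s" "\<tau> = tag P \<omega> i j s m"
      "step P \<omega> C a \<sigma> = (update P \<omega> a j (recv P \<omega> j i s m (parties \<sigma> j)) \<sigma>)
         \<lparr>forged := (forged \<sigma> \<or> (i \<notin> C \<and> Packet i j s m \<tau> \<notin> wire \<sigma>))\<rparr>"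
  | (input) m where "active P C \<sigma> 1" "length m = inst_len P DocSig"
      "step P \<omega> C a \<sigma> = update P \<omega> a 1 (emit (Brb DocSig SEND) m (parties \<sigma> 1)) \<sigma>"
  | (timeout) j where "step P \<omega> C a \<sigma> = update P \<omega> a j ((parties \<sigma> j)\<lparr>aborted := True\<rparr>) \<sigma>"
proof -
  have failed_eq: "\<sigma>'\<lparr>failed := failed \<sigma>'\<rparr> = \<sigma>'" for \<sigma>' :: state
    by simp
  have upd: "update P \<omega> a j p \<sigma> = (update P \<omega> a j p \<sigma>)\<lparr>failed := failed \<sigma>\<rparr>" for j p
    by (simp add: update_def)
  show thesis
  proof (cases a)
    case (Deliver pk)
    obtain i j s m \<tau> where pk: "pk = Packet i j s m \<tau>"
      by (cases pk)
    show ?thesis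
    proof (cases "failed \<sigma> \<or> i \<notin> receivers P \<or> \<not> active P C \<sigma> j \<or> (i = j \<and> pk \<notin> wire \<sigma>)")
      case True
      then have "step P \<omega> C a \<sigma> = update P \<omega> a j (parties \<sigma> j) \<sigma>"
        by (auto simp: Deliver pk Let_def)
      then show ?thesis
        by (intro idle[where fl = "failed \<sigma>"]) (simp only: upd[symmetric])
    next
      case False
      note nf = this
      show ?thesis
      proof (cases "length m = slot_len P s \<and> \<tau> = tag P \<omega> i j s m")
        case True
        with nf show ?thesis
          by (intro deliver[where i = i and j = j and s = s and m = m and \<tau> = \<tau>]) (auto simp: Deliver pk Let_def)
      next
        case f: False
        with nf show ?thesis
          by (intro idle[where j = j and fl = True]) (auto simp: Deliver pk Let_def)
      qed
    qed
  next
    case (Input m)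
    show ?thesis
    proof (cases "\<not> failed \<sigma> \<and> active P C \<sigma> 1 \<and> length m = inst_len P DocSig")
      case True
      then show ?thesis
        by (intro input[where m = m]) (auto simp: Input)
    next
      case False
      then have "step P \<omega> C a \<sigma> = update P \<omega> a 1 (parties \<sigma> 1) \<sigma>"
        by (auto simp: Input Let_def)
      then show ?thesis
        by (intro idle[where fl = "failed \<sigma>"]) (simp only: upd[symmetric])
    qed
  next
    case (Timeout j e)
    show ?thesis
    proof (cases "\<not> failed \<sigma> \<and> active P C \<sigma> j \<and> dlv (parties \<sigma> j) e = None")
      case True
      then show ?thesis
        by (intro timeout[where j = j]) (auto simp: Timeout)
    next
      case False
      then have "step P \<omega> C a \<sigma> = update P \<omega> a j (parties \<sigma> j) \<sigma>"
        by (auto simp: Timeout Let_def)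
      then show ?thesis
        by (intro idle[where fl = "failed \<sigma>"]) (simp only: upd[symmetric])
    qed
  qed
qed

lemma sent_step_mono: "sent (parties \<sigma> j) \<subseteq> sent (parties (step P \<omega> C a \<sigma>) j)"
proof (cases rule: step_cases[of P \<omega> C a \<sigma>])
  case (deliver i j' s m \<tau>)
  show ?thesis
    unfolding deliver(7) by (simp add: sent_recv_mono)
next
  case (input m)
  show ?thesis
    unfolding input(3) by (simp add: sent_emit_subset)
qed simp_all

lemma live_step:
  "failed \<sigma> \<Longrightarrow> failed (step P \<omega> C a \<sigma>)" "forged \<sigma> \<Longrightarrow> forged (step P \<omega> C a \<sigma>)"
  by (cases rule: step_cases[of P \<omega> C a \<sigma>]; simp del: step.simps)+

section \<open>Invariants that survive forgeries\<close>

definition proper_secrets :: "'k ers \<Rightarrow> 'k secrets \<Rightarrow> bool" where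
  "proper_secrets P \<omega> \<longleftrightarrow>
     (\<forall>k\<in>receivers P. length (pairwise \<omega> k) = key_len P) \<and>
     (\<forall>i\<in>receivers P. \<forall>j\<in>receivers P. hkey \<omega> {i, j} \<in> axu_keys P) \<and>
     (\<forall>i\<in>receivers P. \<forall>j\<in>receivers P. \<forall>s. length (pad \<omega> (i, j, s)) = tag_len P)"

definition consistent :: "'k ers \<Rightarrow> 'k secrets \<Rightarrow> nat set \<Rightarrow> state \<Rightarrow> bool" where
  "consistent P \<omega> C \<sigma> \<longleftrightarrow>
     (\<forall>j. sends_well_formed P (parties \<sigma> j)) \<and>
     (\<forall>j. j \<notin> honest P C \<longrightarrow> sent (parties \<sigma> j) = {}) \<and>
     wire \<sigma> = packets P \<omega> (parties \<sigma>)"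

lemma consistent_update:
  assumes "consistent P \<omega> C \<sigma>" and "sends_well_formed P p" and "sent (parties \<sigma> j) \<subseteq> sent p"
    and "j \<notin> honest P C \<Longrightarrow> sent p = {}"
  shows "consistent P \<omega> C (update P \<omega> a j p \<sigma>)"
  using assms wire_update[of \<sigma> P \<omega> j p a] by (simp add: consistent_def)

lemma consistent_flags [simp]:
  "consistent P \<omega> C (\<sigma>\<lparr>failed := b\<rparr>) = consistent P \<omega> C \<sigma>"
  "consistent P \<omega> C (\<sigma>\<lparr>forged := b\<rparr>) = consistent P \<omega> C \<sigma>"
  by (simp_all add: consistent_def)

lemma consistentD:
  assumes "consistent P \<omega> C \<sigma>"
  shows "sends_well_formed P (parties \<sigma> j)" "j \<notin> honest P C \<Longrightarrow> sent (parties \<sigma> j) = {}"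
    "wire \<sigma> = packets P \<omega> (parties \<sigma>)"
  using assms by (simp_all add: consistent_def)

lemma consistent_step:
  assumes "consistent P \<omega> C \<sigma>" and "proper_secrets P \<omega>"
  shows "consistent P \<omega> C (step P \<omega> C a \<sigma>)"
proof (cases rule: step_cases[of P \<omega> C a \<sigma>])
  case (idle j fl)
  have "consistent P \<omega> C (update P \<omega> a j (parties \<sigma> j) \<sigma>)"
    using consistentD[OF assms(1)] by (intro consistent_update[OF assms(1)]) auto
  then show ?thesis
    unfolding idle(1) by simp
next
  case (deliver i j s m \<tau>)
  then have "j \<in> honest P C"
    by (simp add: active_def)
  then show ?thesis
    using assms unfolding deliver(7) consistent_flags
    by (intro consistent_update)
      (auto simp: consistentD sent_recv_mono proper_secrets_def deliver intro!: sends_well_formed_recv)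
next
  case (input m)
  then show ?thesis
    using assms unfolding input(3)
    by (intro consistent_update)
      (auto simp: consistentD sent_emit_mono active_def intro!: sends_well_formed_emit)
next
  case (timeout j)
  then show ?thesis
    using assms consistentD(1,2)[OF assms(1), of j]
      sends_well_formed_cong[of "(parties \<sigma> j)\<lparr>aborted := True\<rparr>" "parties \<sigma> j" P]
    unfolding timeout by (intro consistent_update) auto
qed

lemma consistent_run: "proper_secrets P \<omega> \<Longrightarrow> consistent P \<omega> C (run P \<omega> C A kn n)"
proof (induction n)
  case 0
  then show ?case
    by (simp add: consistent_def init_def wire_def packets_def sends_well_formed_def fresh_party_def)
qed (simp add: Let_def consistent_step)


section \<open>Agreement of the reliable broadcast\<close>

definition acc_sound :: "'k ers \<Rightarrow> nat set \<Rightarrow> state \<Rightarrow> bool" where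
  "acc_sound P C \<sigma> \<longleftrightarrow> (\<forall>j. \<forall>(i, s, m)\<in>acc (parties \<sigma> j).
     i \<in> receivers P \<and> (i \<notin> C \<longrightarrow> (s, m) \<in> sent (parties \<sigma> i)))"

text \<open>The message was sent in \<sigma> already, not merely in the successor state: an accepted
  packet that is not forged was on the wire before the step. This shift in time keeps the induction
  over READY amplification from being circular.\<close>

lemma acc_step_subset:
  assumes "consistent P \<omega> C \<sigma>" and "acc_sound P C \<sigma>" and "\<not> forged (step P \<omega> C a \<sigma>)"
    and x: "(i', s', m') \<in> acc (parties (step P \<omega> C a \<sigma>) j')"
  shows "i' \<in> receivers P" and "i' \<notin> C \<Longrightarrow> (s', m') \<in> sent (parties \<sigma> i')"
proof -
  have old: "i' \<in> receivers P \<and> (i' \<notin> C \<longrightarrow> (s', m') \<in> sent (parties \<sigma> i'))"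
    if "(i', s', m') \<in> acc (parties \<sigma> j')"
    using that assms(2) by (auto simp: acc_sound_def)
  have "i' \<in> receivers P \<and> (i' \<notin> C \<longrightarrow> (s', m') \<in> sent (parties \<sigma> i'))"
  proof (cases rule: step_cases[of P \<omega> C a \<sigma>])
    case (deliver i j s m \<tau>)
    from assms(3) have "i \<notin> C \<longrightarrow> Packet i j s m \<tau> \<in> wire \<sigma>"
      unfolding deliver(7) by auto
    then have new: "i \<notin> C \<longrightarrow> (s, m) \<in> sent (parties \<sigma> i)"
      using consistentD(3)[OF assms(1)] by (auto simp: packets_def)
    from x have "(i', s', m') \<in> acc (parties \<sigma> j') \<or> i' = i \<and> s' = s \<and> m' = m"
      unfolding deliver(7) by (auto simp: acc_recv split: if_splits slot.splits)
    then show ?thesis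
      using old new deliver(3) by blast
  next
    case (idle j fl)
    with x old show ?thesis
      by (simp del: step.simps split: if_splits)
  next
    case (input m)
    with x old show ?thesis
      by (simp del: step.simps split: if_splits)
  next
    case (timeout j)
    with x old show ?thesis
      by (simp del: step.simps split: if_splits)
  qed
  then show "i' \<in> receivers P" and "i' \<notin> C \<Longrightarrow> (s', m') \<in> sent (parties \<sigma> i')"
    by blast+
qed

lemma acc_sound_step:
  assumes "consistent P \<omega> C \<sigma>" and "acc_sound P C \<sigma>" and "\<not> forged (step P \<omega> C a \<sigma>)"
  shows "acc_sound P C (step P \<omega> C a \<sigma>)"
  unfolding acc_sound_def
  using acc_step_subset[OF assms] sent_step_mono[of \<sigma> _ P \<omega> C a] by fast

lemma acc_step_mono: "acc (parties \<sigma> j) \<subseteq> acc (parties (step P \<omega> C a \<sigma>) j)"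
proof (cases rule: step_cases[of P \<omega> C a \<sigma>])
  case (deliver i j' s m \<tau>)
  show ?thesis
    unfolding deliver(7) by (auto simp: acc_recv split: slot.split)
qed simp_all

lemma finite_voters:
  assumes "acc_sound P C \<sigma>"
  shows "{i. (i, s, m) \<in> acc (parties \<sigma> j)} \<subseteq> receivers P"
    and "finite {i. (i, s, m) \<in> acc (parties \<sigma> j)}"
proof -
  show *: "{i. (i, s, m) \<in> acc (parties \<sigma> j)} \<subseteq> receivers P"
    using assms by (auto simp: acc_sound_def)
  show "finite {i. (i, s, m) \<in> acc (parties \<sigma> j)}"
    by (rule finite_subset[OF *]) (simp add: receivers_def)
qed

section \<open>The quorum invariant along a run\<close>

lemma votes_step_mono:
  assumes "acc_sound P C (step P \<omega> C a \<sigma>)"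
  shows "votes (parties \<sigma> j) s m \<le> votes (parties (step P \<omega> C a \<sigma>) j) s m"
  unfolding votes_def using acc_step_mono[of \<sigma> j P \<omega> C a]
  by (intro card_mono finite_voters[OF assms]) auto

text \<open>The quorum of echoes may sit at another receiver k, because a READY triggered by
  amplification only repeats the READY of others.\<close>

definition quorum_sound :: "'k ers \<Rightarrow> state \<Rightarrow> bool" where
  "quorum_sound P \<sigma> \<longleftrightarrow>
     (\<forall>j e m. (Brb e READY, m) \<in> sent (parties \<sigma> j) \<longrightarrow>
        (\<exists>k. echo_quorum P \<le> votes (parties \<sigma> k) (Brb e ECHO) m)) \<and>
     (\<forall>j e m. dlv (parties \<sigma> j) e = Some m \<longrightarrow>
        2 * flt P + 1 \<le> votes (parties \<sigma> j) (Brb e READY) m)"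

lemma quorum_sound_step:
  assumes cons: "consistent P \<omega> C \<sigma>" and acc: "acc_sound P C \<sigma>" and qs: "quorum_sound P \<sigma>"
    and nf: "\<not> forged (step P \<omega> C a \<sigma>)" and C: "finite C" "card C \<le> flt P"
  shows "quorum_sound P (step P \<omega> C a \<sigma>)"
proof -
  let ?\<sigma>' = "step P \<omega> C a \<sigma>"
  have acc': "acc_sound P C ?\<sigma>'"
    by (rule acc_sound_step[OF cons acc nf])
  note mono = votes_step_mono[OF acc']
  have old_ready: "\<exists>k. echo_quorum P \<le> votes (parties ?\<sigma>' k) (Brb e ECHO) m"
    if "(Brb e READY, m) \<in> sent (parties \<sigma> j)" for j e m
    using that qs mono unfolding quorum_sound_def by (meson order_trans)
  have old_dlv: "2 * flt P + 1 \<le> votes (parties ?\<sigma>' j) (Brb e READY) m"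
    if "dlv (parties \<sigma> j) e = Some m" for j e m
    using that qs mono unfolding quorum_sound_def by (meson order_trans)
  \<comment> \<open>More than \<open>flt P\<close> sources of READY include an honest one, whose
    READY predates this step; the invariant of \<sigma> then supplies the echo quorum.\<close>
  have amplify: "\<exists>k. echo_quorum P \<le> votes (parties ?\<sigma>' k) (Brb e ECHO) m"
    if v: "flt P + 1 \<le> votes (parties ?\<sigma>' j) (Brb e READY) m" for j e m
  proof -
    have "card C < card {i. (i, Brb e READY, m) \<in> acc (parties ?\<sigma>' j)}"
      using v C(2) by (simp add: votes_def)
    then have "\<not> {i. (i, Brb e READY, m) \<in> acc (parties ?\<sigma>' j)} \<subseteq> C"
      using card_mono[OF C(1)] by (meson not_le)
    then obtain i where "(i, Brb e READY, m) \<in> acc (parties ?\<sigma>' j)" "i \<notin> C"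
      by blast
    then show ?thesis
      using acc_step_subset(2)[OF cons acc nf] old_ready by blast
  qed
  have "\<exists>k. echo_quorum P \<le> votes (parties ?\<sigma>' k) (Brb e ECHO) m"
    if r: "(Brb e READY, m) \<in> sent (parties ?\<sigma>' j)" for j e m
  proof (cases rule: step_cases[of P \<omega> C a \<sigma>])
    case (deliver i j' s m' \<tau>)
    then have p: "parties ?\<sigma>' = (parties \<sigma>)(j' := recv P \<omega> j' i s m' (parties \<sigma> j'))"
      by (simp del: step.simps)
    show ?thesis
    proof (cases "j = j'")
      case True
      then have "(Brb e READY, m) \<in> sent (recv P \<omega> j' i s m' (parties \<sigma> j'))"
        using r p by simp
      from ready_recvD[OF this] show ?thesis
        using old_ready amplify[of j'] p by (metis fun_upd_same)
    qed (use r p old_ready in auto)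
  next
    case (idle j' fl)
    with r old_ready show ?thesis
      by (simp del: step.simps split: if_splits)
  next
    case (input m')
    have "(Brb e READY, m) \<in> sent (parties \<sigma> j)"
      using r unfolding input(3) by (auto dest: sent_emitD split: if_splits)
    with r old_ready show ?thesis
      by blast
  next
    case (timeout j')
    have "(Brb e READY, m) \<in> sent (parties \<sigma> j)"
      using r unfolding timeout by (auto split: if_splits)
    with old_ready show ?thesis
      by blast
  qed
  moreover have "2 * flt P + 1 \<le> votes (parties ?\<sigma>' j) (Brb e READY) m"
    if d: "dlv (parties ?\<sigma>' j) e = Some m" for j e m
  proof (cases rule: step_cases[of P \<omega> C a \<sigma>])
    case (deliver i j' s m' \<tau>)
    then have p: "parties ?\<sigma>' = (parties \<sigma>)(j' := recv P \<omega> j' i s m' (parties \<sigma> j'))"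
      by (simp del: step.simps)
    show ?thesis
    proof (cases "j = j'")
      case True
      then have "dlv (recv P \<omega> j' i s m' (parties \<sigma> j')) e = Some m"
        using d p by simp
      from dlv_recvD[OF this] show ?thesis
        using old_dlv[of j' e m] p True by auto
    qed (use d p old_dlv[of j e m] in auto)
  next
    case (idle j' fl)
    have "dlv (parties \<sigma> j) e = Some m"
      using d unfolding idle(1) by (auto split: if_splits)
    then show ?thesis
      by (rule old_dlv)
  next
    case (input m')
    have "dlv (parties \<sigma> j) e = Some m"
      using d unfolding input(3) by (auto split: if_splits)
    then show ?thesis
      by (rule old_dlv)
  next
    case (timeout j')
    have "dlv (parties \<sigma> j) e = Some m"
      using d unfolding timeout by (auto split: if_splits)
    then show ?thesis
      by (rule old_dlv)
  qed
  ultimately show ?thesis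
    unfolding quorum_sound_def by blast
qed

lemma brb_sound_run:
  assumes "proper_secrets P \<omega>" and "finite C" and "card C \<le> flt P"
    and "\<not> forged (run P \<omega> C A kn n)"
  shows "acc_sound P C (run P \<omega> C A kn n) \<and> quorum_sound P (run P \<omega> C A kn n)"
  using assms(4)
proof (induction n)
  case 0
  then show ?case
    by (simp add: acc_sound_def quorum_sound_def init_def fresh_party_def)
next
  case (Suc n)
  then show ?case
    using consistent_run[OF assms(1), of C A kn n] live_step(2) assms(2,3)
    unfolding run.simps Let_def by (meson acc_sound_step quorum_sound_step)
qed

text \<open>Twice the quorum is at least N + t + 1, so two quorums among N sources share at least t
  + 1 of them. One of these is honest and has echoed only one string in this instance.\<close>

lemma echo_quorum_unique:
  assumes cons: "consistent P \<omega> C \<sigma>" and acc: "acc_sound P C \<sigma>"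
    and C: "finite C" "card C \<le> flt P"
    and q: "echo_quorum P \<le> votes (parties \<sigma> k) (Brb e ECHO) m"
    and q': "echo_quorum P \<le> votes (parties \<sigma> k') (Brb e ECHO) m'"
  shows "m = m'"
proof -
  let ?V = "{i. (i, Brb e ECHO, m) \<in> acc (parties \<sigma> k)}"
  let ?V' = "{i. (i, Brb e ECHO, m') \<in> acc (parties \<sigma> k')}"
  have "card (?V \<union> ?V') \<le> card (receivers P)"
    using finite_voters(1)[OF acc] by (intro card_mono) (auto simp: receivers_def)
  then have "card ?V + card ?V' \<le> rcvs P + card (?V \<inter> ?V')"
    using card_Un_Int[OF finite_voters(2)[OF acc] finite_voters(2)[OF acc]]
    by (simp add: receivers_def)
  moreover have "rcvs P + flt P + 1 \<le> 2 * echo_quorum P"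
  proof -
    have "(real (rcvs P) + real (flt P) + 1) / 2 \<le> real (echo_quorum P)"
      unfolding echo_quorum_def by (rule real_nat_ceiling_ge)
    then have "real (rcvs P + flt P + 1) \<le> real (2 * echo_quorum P)"
      by simp
    then show ?thesis
      by (simp only: of_nat_le_iff)
  qed
  ultimately have "card C < card (?V \<inter> ?V')"
    using q q' C(2) unfolding votes_def by linarith
  then have "\<not> ?V \<inter> ?V' \<subseteq> C"
    using card_mono[OF C(1)] by (meson not_le)
  then obtain i where "i \<notin> C" "(i, Brb e ECHO, m) \<in> acc (parties \<sigma> k)"
    "(i, Brb e ECHO, m') \<in> acc (parties \<sigma> k')"
    by blast
  then have "(Brb e ECHO, m) \<in> sent (parties \<sigma> i)" "(Brb e ECHO, m') \<in> sent (parties \<sigma> i)"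
    using acc by (auto simp: acc_sound_def)
  then show ?thesis
    using consistentD(1)[OF cons, of i] unfolding sends_well_formed_def by blast
qed

text \<open>Among the 2t + 1 sources of READY behind a delivery one is honest, and its READY traces
  back to an echo quorum for the delivered string; echo quorums of one instance agree.\<close>

lemma brb_agreement:
  assumes cons: "consistent P \<omega> C \<sigma>" and acc: "acc_sound P C \<sigma>" and qs: "quorum_sound P \<sigma>"
    and C: "finite C" "card C \<le> flt P"
    and d: "dlv (parties \<sigma> j) e = Some m" and d': "dlv (parties \<sigma> j') e = Some m'"
  shows "m = m'"
proof -
  have "\<exists>k. echo_quorum P \<le> votes (parties \<sigma> k) (Brb e ECHO) m"
    if "dlv (parties \<sigma> j) e = Some m" for j m
  proof -
    have "card C < card {i. (i, Brb e READY, m) \<in> acc (parties \<sigma> j)}"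
      using that qs C(2) unfolding quorum_sound_def votes_def by fastforce
    then have "\<not> {i. (i, Brb e READY, m) \<in> acc (parties \<sigma> j)} \<subseteq> C"
      using card_mono[OF C(1)] by (meson not_le)
    then obtain i where "i \<notin> C" "(i, Brb e READY, m) \<in> acc (parties \<sigma> j)"
      by blast
    then have "(Brb e READY, m) \<in> sent (parties \<sigma> i)"
      using acc by (auto simp: acc_sound_def)
    then show ?thesis
      using qs by (auto simp: quorum_sound_def)
  qed
  then show ?thesis
    using d d' echo_quorum_unique[OF cons acc C] by blast
qed

text \<open>A verdict is a function of the flag \<open>failed\<close> and of the two delivered
  strings. The timeout condition excludes that only some honest receivers deliver, and agreement
  makes the delivered strings equal.\<close>

lemma not_repudiated:
  assumes "proper_secrets P \<omega>" and C: "finite C" "card C \<le> flt P"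
    and \<sigma>: "\<sigma> = run P \<omega> C A kn n"
    and ok: "\<And>e. (\<forall>i\<in>honest P C. dlv (parties \<sigma> i) e \<noteq> None) \<or> (\<forall>i\<in>honest P C. dlv (parties \<sigma> i) e = None)"
    and nf: "\<not> forged \<sigma>"
  shows "\<not> repudiated P C \<sigma>"
proof -
  have dlv_eq: "dlv (parties \<sigma> i) e = dlv (parties \<sigma> j) e" if "i \<in> honest P C" "j \<in> honest P C" for i j e
  proof (cases "dlv (parties \<sigma> i) e")
    case None
    then show ?thesis
      using ok[of e] that by metis
  next
    case (Some m)
    then have "dlv (parties \<sigma> j) e \<noteq> None"
      using ok[of e] that by (metis option.distinct(1))
    then obtain m' where "dlv (parties \<sigma> j) e = Some m'"
      by blast
    with Some show ?thesis
      using brb_agreement[OF consistent_run[OF assms(1)] _ _ C, of A kn n i e m j m']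
        brb_sound_run[OF assms(1) C nf[unfolded \<sigma>]] \<sigma> by simp
  qed
  show ?thesis
    unfolding repudiated_def verdict_def using dlv_eq by (metis (no_types, lifting))
qed


section \<open>The first forgery\<close>

text \<open>A zero \<open>key_len\<close> would force both \<open>hash_len\<close> and
  \<open>sigma\<close> to vanish, and the inequality that defines \<open>sigma\<close> would then
  read \<open>doc_len P \<le> 0\<close>. Positive length guarantees a second string for the stand-in
  of \<open>cover\<close>.\<close>

lemma slot_len_pos:
  assumes "0 < doc_len P"
  shows "0 < slot_len P s"
proof -
  have "doc_len P \<le> (hash_len P + sigma P) * (1 + 2 ^ sigma P)"
    unfolding sigma_def
  proof (rule LeastI)
    \<comment> \<open>The witness \<open>doc_len P\<close> merely shows that the minimum is taken
      over a nonempty set.\<close>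
    show "doc_len P \<le> (hash_len P + doc_len P) * (1 + 2 ^ doc_len P)"
      by simp
  qed
  then have "0 < key_len P"
    using assms by (auto simp: key_len_def intro!: Nat.gr0I)
  moreover obtain e where "s = Share \<or> slot_len P s = inst_len P e"
    by (cases s) auto
  ultimately show ?thesis
    using assms by (cases e) auto
qed

text \<open>The string masked by the pad of a slot: the one that was sent, or, if there is none, a stand-in
  that differs from the forged string x, so that the AXU property applies to both cases alike.\<close>

definition cover :: "'k ers \<Rightarrow> state \<Rightarrow> bits \<Rightarrow> nat \<Rightarrow> nat \<Rightarrow> slot \<Rightarrow> bits" where
  "cover P \<sigma> x i j s =
     (if j \<in> recipients P s \<and> (\<exists>m. (s, m) \<in> sent (parties \<sigma> i))
      then THE m. (s, m) \<in> sent (parties \<sigma> i)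
      else SOME m. length m = slot_len P s \<and> m \<noteq> x)"

text \<open>The image of the pads under the change of variables, with x the string forged in state sigma.\<close>

definition masked :: "'k ers \<Rightarrow> 'k secrets \<Rightarrow> nat set \<Rightarrow> state \<Rightarrow> bits \<Rightarrow> nat \<times> nat \<times> slot \<Rightarrow> bits" where
  "masked P \<omega> C \<sigma> x = (\<lambda>(i, j, s).
     if i \<in> honest P C \<and> j \<in> honest P C then tag P \<omega> i j s (cover P \<sigma> x i j s) else pad \<omega> (i, j, s))"

text \<open>Described in the state before the acceptance, so that the run leading to it is free of
  failures and forgeries and can be compared across different secrets.\<close>

definition breach ::
  "'k ers \<Rightarrow> 'k secrets \<Rightarrow> nat set \<Rightarrow> state \<Rightarrow> action \<Rightarrow> nat \<Rightarrow> nat \<Rightarrow> slot \<Rightarrow> bits \<Rightarrow> bool" where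
  "breach P \<omega> C \<sigma> a i j s m \<longleftrightarrow>
     a = Deliver (Packet i j s m (tag P \<omega> i j s m)) \<and> \<not> failed \<sigma> \<and> \<not> forged \<sigma> \<and>
     i \<in> honest P C \<and> active P C \<sigma> j \<and> i \<noteq> j \<and> Packet i j s m (tag P \<omega> i j s m) \<notin> wire \<sigma> \<and>
     length m = slot_len P s"

text \<open>The value does not depend on x. Hence the tags of strings sent in two runs can be
  compared before the two forged strings are known to coincide.\<close>

lemma cover_sent:
  assumes "consistent P \<omega> C \<sigma>" and "j \<in> recipients P s" and "(s, m) \<in> sent (parties \<sigma> i)"
  shows "cover P \<sigma> x i j s = m"
  using assms consistentD(1)[OF assms(1), of i]
  unfolding cover_def sends_well_formed_def by (auto intro!: the_equality)

lemma some_other_string: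
  assumes "0 < n"
  shows "\<exists>y::bits. length y = n \<and> y \<noteq> x"
proof -
  have "replicate n True \<noteq> replicate n False"
    using assms by simp
  then show ?thesis
    by (metis length_replicate)
qed

lemma length_cover:
  assumes "consistent P \<omega> C \<sigma>" and "0 < doc_len P"
  shows "length (cover P \<sigma> x i j s) = slot_len P s"
proof (cases "j \<in> recipients P s \<and> (\<exists>m. (s, m) \<in> sent (parties \<sigma> i))")
  case True
  then show ?thesis
    using cover_sent[OF assms(1)] consistentD(1)[OF assms(1), of i]
    unfolding sends_well_formed_def by metis
next
  case False
  then show ?thesis
    using someI_ex[OF some_other_string[OF slot_len_pos[OF assms(2)], of s x]]
    unfolding cover_def by auto
qed

text \<open>A string sent in this slot to j is on the wire with its genuine tag, so a packet off the
  wire with a valid tag carries another string. Without such a string, the stand-in differs from m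
  by choice.\<close>

lemma cover_breach:
  assumes "consistent P \<omega> C \<sigma>" and "0 < doc_len P" and "breach P \<omega> C \<sigma> a i j s m"
  shows "cover P \<sigma> m i j s \<noteq> m"
proof (cases "j \<in> recipients P s \<and> (\<exists>m'. (s, m') \<in> sent (parties \<sigma> i))")
  case True
  then obtain m' where m': "j \<in> recipients P s" "(s, m') \<in> sent (parties \<sigma> i)"
    by blast
  then have "Packet i j s m' (tag P \<omega> i j s m') \<in> wire \<sigma>"
    unfolding consistentD(3)[OF assms(1)] packets_def by blast
  then have "m' \<noteq> m"
    using assms(3) by (auto simp: breach_def)
  then show ?thesis
    using cover_sent[OF assms(1) m'] by simp
next
  case False
  then show ?thesis
    using someI_ex[OF some_other_string[OF slot_len_pos[OF assms(2)], of s m]]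
    unfolding cover_def by auto
qed

section \<open>Attempts at forgery within a run\<close>

lemma run_mono:
  assumes "n \<le> N"
  shows "sent (parties (run P \<omega> C A kn n) j) \<subseteq> sent (parties (run P \<omega> C A kn N) j)"
    and "failed (run P \<omega> C A kn n) \<Longrightarrow> failed (run P \<omega> C A kn N)"
    and "forged (run P \<omega> C A kn n) \<Longrightarrow> forged (run P \<omega> C A kn N)"
proof -
  show "sent (parties (run P \<omega> C A kn n) j) \<subseteq> sent (parties (run P \<omega> C A kn N) j)"
    using assms
  proof (induction N rule: dec_induct)
    case (step N)
    then show ?case
      unfolding run.simps Let_def by (blast intro: subsetD[OF sent_step_mono])
  qed simp
  show "failed (run P \<omega> C A kn N)" if "failed (run P \<omega> C A kn n)"
    using assms that by (induction N rule: dec_induct) (simp_all add: Let_def live_step)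
  show "forged (run P \<omega> C A kn N)" if "forged (run P \<omega> C A kn n)"
    using assms that by (induction N rule: dec_induct) (simp_all add: Let_def live_step)
qed

text \<open>The breach is the step at which \<open>forged\<close> rises. Failure is permanent, so
  its absence at the end gives its absence there.\<close>

lemma forged_imp_breach:
  assumes "forged (run P \<omega> C A kn n)" and "\<not> failed (run P \<omega> C A kn n)"
  shows "\<exists>n i j s m. breach P \<omega> C (run P \<omega> C A kn n) (A kn (hist (run P \<omega> C A kn n))) i j s m"
  using assms
proof (induction n)
  case 0
  then show ?case
    by (simp add: init_def)
next
  case (Suc n)
  let ?\<sigma> = "run P \<omega> C A kn n"
  let ?a = "A kn (hist ?\<sigma>)"
  have forged: "forged (step P \<omega> C ?a ?\<sigma>)" and live: "\<not> failed ?\<sigma>"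
    using Suc.prems live_step(1)[of ?\<sigma> P \<omega> C ?a] unfolding run.simps Let_def by blast+
  show ?case
  proof (cases "forged ?\<sigma>")
    case True
    then show ?thesis
      using Suc.IH live by blast
  next
    case False
    show ?thesis
    proof (cases rule: step_cases[of P \<omega> C ?a ?\<sigma>])
      case (deliver i j s m \<tau>)
      have "i \<notin> C \<and> Packet i j s m \<tau> \<notin> wire ?\<sigma>"
        using forged False unfolding deliver(7) by simp
      then have "breach P \<omega> C ?\<sigma> ?a i j s m"
        using deliver(1-6) False live unfolding breach_def by auto
      then show ?thesis
        by blast
    qed (use forged False in \<open>simp_all del: step.simps\<close>)
  qed
qed

text \<open>Accepted or rejected, such an attempt raises a flag. Consequently, in a run without
  flags every packet processed between distinct honest receivers is genuine, and a run with a first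
  attempt cannot be prolonged without a flag.\<close>

lemma attempt_ends_run:
  assumes "\<not> failed \<sigma>" and "i \<in> honest P C" and "active P C \<sigma> j" and "i \<noteq> j"
    and "Packet i j s m \<tau> \<notin> wire \<sigma>"
  shows "failed (step P \<omega> C (Deliver (Packet i j s m \<tau>)) \<sigma>) \<or>
         forged (step P \<omega> C (Deliver (Packet i j s m \<tau>)) \<sigma>)"
  using assms by (simp add: Let_def)

section \<open>How a run depends on the secrets\<close>

lemma recv_cong:
  assumes "pairwise \<omega> = pairwise \<omega>'"
  shows "recv P \<omega> = recv P \<omega>'"
  by (intro ext) (simp only: recv_def key_react_def assms)

lemma update_cong:
  assumes "\<And>k s m. (s, m) \<in> sent p - sent (parties \<sigma> j) \<Longrightarrow> k \<in> recipients P s \<Longrightarrow>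
    tag P \<omega> j k s m = tag P \<omega>' j k s m"
  shows "update P \<omega> a j p \<sigma> = update P \<omega>' a j p \<sigma>"
proof -
  have "{Packet j k s m (tag P \<omega> j k s m) |k s m. (s, m) \<in> sent p - sent (parties \<sigma> j) \<and> k \<in> recipients P s} =
    {Packet j k s m (tag P \<omega>' j k s m) |k s m. (s, m) \<in> sent p - sent (parties \<sigma> j) \<and> k \<in> recipients P s}"
    by (intro Collect_cong ex_cong1) (use assms in auto)
  then show ?thesis
    unfolding update_def by simp
qed

text \<open>Apart from the pairwise keys, secrets enter a step only through the acceptance test and
  the tags of new packets. The messages to be sent are fixed before tags are attached, so agreement
  is demanded only for messages sent under both secrets.\<close>

lemma step_eq_if_tags_agree:
  assumes cons: "consistent P \<omega> C \<sigma>" "consistent P \<omega>' C \<sigma>"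
    and pw: "pairwise \<omega> = pairwise \<omega>'"
    and known: "\<And>i j s m. i \<in> C \<Longrightarrow> tag P \<omega> i j s m = tag P \<omega>' i j s m"
    and live: "\<not> failed (step P \<omega> C a \<sigma>)" "\<not> forged (step P \<omega> C a \<sigma>)"
    and tags: "\<And>j k s m. j \<in> honest P C \<Longrightarrow> k \<in> recipients P s \<Longrightarrow>
      (s, m) \<in> sent (parties (step P \<omega> C a \<sigma>) j) \<Longrightarrow>
      (s, m) \<in> sent (parties (step P \<omega>' C a \<sigma>) j) \<Longrightarrow> tag P \<omega> j k s m = tag P \<omega>' j k s m"
  shows "step P \<omega> C a \<sigma> = step P \<omega>' C a \<sigma>"
proof (cases a)
  case (Deliver pk)
  obtain i j s m \<tau> where pk: "pk = Packet i j s m \<tau>"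
    by (cases pk)
  have idle: "update P \<omega> a j (parties \<sigma> j) \<sigma> = update P \<omega>' a j (parties \<sigma> j) \<sigma>"
    by (rule update_cong) simp
  show ?thesis
  proof (cases "failed \<sigma> \<or> i \<notin> receivers P \<or> \<not> active P C \<sigma> j \<or> (i = j \<and> pk \<notin> wire \<sigma>)")
    case True
    then have "step P \<omega> C a \<sigma> = update P \<omega> a j (parties \<sigma> j) \<sigma>"
      "step P \<omega>' C a \<sigma> = update P \<omega>' a j (parties \<sigma> j) \<sigma>"
      by (auto simp: Deliver pk Let_def)
    then show ?thesis
      using idle by simp
  next
    case False
    then have jH: "j \<in> honest P C"
      by (simp add: active_def)
    \<comment> \<open>For an honest source the packet lies on the wire, which equals
      \<open>packets\<close> under both secrets, so the test succeeds under both.\<close>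
    have \<tau>: "\<tau> = tag P \<omega> i j s m \<longleftrightarrow> \<tau> = tag P \<omega>' i j s m"
    proof (cases "i \<in> C")
      case False
      have "pk \<in> wire \<sigma>"
        using attempt_ends_run[of \<sigma> i P C j s m \<tau> \<omega>] live False
          \<open>\<not> (failed \<sigma> \<or> i \<notin> receivers P \<or> \<not> active P C \<sigma> j \<or> (i = j \<and> pk \<notin> wire \<sigma>))\<close>
        unfolding Deliver pk by blast
      then have "pk \<in> packets P \<omega> (parties \<sigma>)" "pk \<in> packets P \<omega>' (parties \<sigma>)"
        using consistentD(3)[OF cons(1)] consistentD(3)[OF cons(2)] by simp_all
      then show ?thesis
        by (auto simp: pk packets_def)
    qed (simp add: known)
    show ?thesis
    proof (cases "length m = slot_len P s \<and> \<tau> = tag P \<omega> i j s m")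
      case True
      let ?p = "recv P \<omega> j i s m (parties \<sigma> j)"
      have eqs: "step P \<omega> C a \<sigma> = (update P \<omega> a j ?p \<sigma>)
            \<lparr>forged := forged \<sigma> \<or> i \<notin> C \<and> pk \<notin> wire \<sigma>\<rparr>"
        "step P \<omega>' C a \<sigma> = (update P \<omega>' a j ?p \<sigma>)
            \<lparr>forged := forged \<sigma> \<or> i \<notin> C \<and> pk \<notin> wire \<sigma>\<rparr>"
        using False True \<tau> recv_cong[OF pw, of P] by (auto simp: Deliver pk Let_def)
      have "update P \<omega> a j ?p \<sigma> = update P \<omega>' a j ?p \<sigma>"
        using tags[OF jH] unfolding eqs by (intro update_cong) simp
      then show ?thesis
        unfolding eqs by simp
    next
      case rejected: False
      have "step P \<omega> C a \<sigma> = (update P \<omega> a j (parties \<sigma> j) \<sigma>)\<lparr>failed := True\<rparr>"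
        using False rejected by (auto simp: Deliver pk Let_def)
      moreover have "step P \<omega>' C a \<sigma> = (update P \<omega>' a j (parties \<sigma> j) \<sigma>)\<lparr>failed := True\<rparr>"
        using False rejected \<tau> by (auto simp: Deliver pk Let_def)
      ultimately show ?thesis
        using idle by simp
    qed
  qed
next
  case (Input m)
  define p where "p = (if \<not> failed \<sigma> \<and> active P C \<sigma> 1 \<and> length m = inst_len P DocSig
    then emit (Brb DocSig SEND) m (parties \<sigma> 1) else parties \<sigma> 1)"
  have eqs: "step P \<omega> C a \<sigma> = update P \<omega> a 1 p \<sigma>" "step P \<omega>' C a \<sigma> = update P \<omega>' a 1 p \<sigma>"
    by (simp_all add: Input p_def Let_def)
  have "1 \<in> honest P C" if "sent p - sent (parties \<sigma> 1) \<noteq> {}"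
    using that by (auto simp: p_def active_def split: if_splits)
  then show ?thesis
    using tags[of 1] unfolding eqs by (intro update_cong) auto
next
  case (Timeout j e)
  define p where "p = (if \<not> failed \<sigma> \<and> active P C \<sigma> j \<and> dlv (parties \<sigma> j) e = None
    then (parties \<sigma> j)\<lparr>aborted := True\<rparr> else parties \<sigma> j)"
  have eqs: "step P \<omega> C a \<sigma> = update P \<omega> a j p \<sigma>" "step P \<omega>' C a \<sigma> = update P \<omega>' a j p \<sigma>"
    by (simp_all add: Timeout p_def Let_def)
  have "sent p = sent (parties \<sigma> j)"
    by (simp add: p_def)
  then show ?thesis
    unfolding eqs by (intro update_cong) simp
qed

text \<open>The final times N and N' may differ, as the lengths of the two runs are compared only
  later. Absence of flags is required under \<omega> alone and carries over along the common part of
  the runs.\<close>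

lemma run_eq_if_tags_agree:
  assumes proper: "proper_secrets P \<omega>" "proper_secrets P \<omega>'"
    and pw: "pairwise \<omega> = pairwise \<omega>'"
    and known: "\<And>i j s m. i \<in> C \<Longrightarrow> tag P \<omega> i j s m = tag P \<omega>' i j s m"
    and live: "\<not> failed (run P \<omega> C A kn N)" "\<not> forged (run P \<omega> C A kn N)"
    and tags: "\<And>j k s m. j \<in> honest P C \<Longrightarrow> k \<in> recipients P s \<Longrightarrow>
      (s, m) \<in> sent (parties (run P \<omega> C A kn N) j) \<Longrightarrow>
      (s, m) \<in> sent (parties (run P \<omega>' C A kn N') j) \<Longrightarrow> tag P \<omega> j k s m = tag P \<omega>' j k s m"
    and "n \<le> N" "n \<le> N'"
  shows "run P \<omega> C A kn n = run P \<omega>' C A kn n"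
  using assms(8,9)
proof (induction n)
  case (Suc n)
  let ?\<sigma> = "run P \<omega> C A kn n"
  let ?a = "A kn (hist ?\<sigma>)"
  have eq: "run P \<omega>' C A kn n = ?\<sigma>"
    using Suc by simp
  have Suc_eq: "run P \<omega> C A kn (Suc n) = step P \<omega> C ?a ?\<sigma>"
    "run P \<omega>' C A kn (Suc n) = step P \<omega>' C ?a ?\<sigma>"
    by (simp_all add: Let_def eq)
  have "step P \<omega> C ?a ?\<sigma> = step P \<omega>' C ?a ?\<sigma>"
  proof (rule step_eq_if_tags_agree[OF _ _ pw known])
    show "consistent P \<omega> C ?\<sigma>"
      by (rule consistent_run[OF proper(1)])
    show "consistent P \<omega>' C ?\<sigma>"
      unfolding eq[symmetric] by (rule consistent_run[OF proper(2)])
    show "\<not> failed (step P \<omega> C ?a ?\<sigma>)" "\<not> forged (step P \<omega> C ?a ?\<sigma>)"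
      using live run_mono(2,3)[OF Suc.prems(1), of P \<omega> C A kn] unfolding Suc_eq by blast+
    show "tag P \<omega> j k s m = tag P \<omega>' j k s m"
      if "j \<in> honest P C" "k \<in> recipients P s" "(s, m) \<in> sent (parties (step P \<omega> C ?a ?\<sigma>) j)"
        "(s, m) \<in> sent (parties (step P \<omega>' C ?a ?\<sigma>) j)" for j k s m
      using that tags[of j k s m] run_mono(1)[OF Suc.prems(1)] run_mono(1)[OF Suc.prems(2)]
      unfolding Suc_eq[symmetric] by blast
  qed
  then show ?case
    unfolding Suc_eq .
qed simp

text \<open>The premise says that there is a receiver at all, so that receiver 1, the recipient of
  \<open>Share\<close>, exists.\<close>

lemma recipients_subset: "j \<in> receivers P \<Longrightarrow> recipients P s \<subseteq> receivers P"
  by (cases s) (auto simp: receivers_def)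

lemma knowledge_cong:
  assumes "pairwise \<omega> = pairwise \<omega>'" and "pick \<omega> = pick \<omega>'"
    and "\<And>U. U \<inter> C \<noteq> {} \<Longrightarrow> hkey \<omega> U = hkey \<omega>' U"
    and "\<And>i j s. i \<in> C \<or> j \<in> C \<Longrightarrow> pad \<omega> (i, j, s) = pad \<omega>' (i, j, s)"
  shows "knowledge P \<omega> C b doc = knowledge P \<omega>' C b doc"
proof -
  have "signed P \<omega> doc = signed P \<omega>' doc"
    unfolding signed_def by (simp only: assms(1,2))
  moreover have "(\<lambda>U. if U \<inter> C \<noteq> {} then Some (hkey \<omega> U) else None) =
      (\<lambda>U. if U \<inter> C \<noteq> {} then Some (hkey \<omega>' U) else None)"
    using assms(3) by auto
  moreover have "(\<lambda>(i, j, s). if i \<in> C \<or> j \<in> C then Some (pad \<omega> (i, j, s)) else None) =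
      (\<lambda>(i, j, s). if i \<in> C \<or> j \<in> C then Some (pad \<omega>' (i, j, s)) else None)"
    using assms(4) by auto
  ultimately show ?thesis
    unfolding knowledge_def by (simp only: assms(1))
qed


section \<open>Probability of a forgery\<close>

text \<open>Equal \<open>masked\<close> values give the coalition equal knowledge and give every
  message sent in both runs equal tags, so the runs coincide up to the shorter time. The attempt
  made there would raise a flag in the longer run, hence the times agree, and the strategy makes the
  same attempt with the same tag.\<close>

lemma breach_unique:
  assumes proper: "proper_secrets P \<omega>" "proper_secrets P \<omega>'"
    and pw: "pairwise \<omega> = pairwise \<omega>'" and pick: "pick \<omega> = pick \<omega>'"
    and hk: "\<And>U. U \<inter> C \<noteq> {} \<Longrightarrow> hkey \<omega> U = hkey \<omega>' U"
    and kn: "kn = knowledge P \<omega> C b doc" "kn' = knowledge P \<omega>' C b doc"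
    and \<sigma>: "\<sigma> = run P \<omega> C A kn N" "\<sigma>' = run P \<omega>' C A kn' N'"
    and breach: "breach P \<omega> C \<sigma> (A kn (hist \<sigma>)) i j s m"
    and breach': "breach P \<omega>' C \<sigma>' (A kn' (hist \<sigma>')) i' j' s' m'"
    and masked: "masked P \<omega> C \<sigma> m = masked P \<omega>' C \<sigma>' m'"
  shows "\<sigma> = \<sigma>' \<and> i = i' \<and> j = j' \<and> s = s' \<and> m = m' \<and> tag P \<omega> i j s m = tag P \<omega>' i j s m"
proof -
  have pads: "pad \<omega> (k, l, q) = pad \<omega>' (k, l, q)" if "k \<in> C \<or> l \<in> C" for k l q
    using fun_cong[OF masked, of "(k, l, q)"] that by (auto simp: masked_def)
  have kn_eq: "kn' = kn"
    unfolding kn by (intro knowledge_cong[symmetric] pw pick hk pads)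
  have known: "tag P \<omega> k l q x = tag P \<omega>' k l q x" if "k \<in> C \<or> l \<in> C" for k l q x
    using pads[OF that, of q] hk[of "{k, l}"] that by (auto simp: tag_def)
  have live: "\<not> failed \<sigma>" "\<not> forged \<sigma>" "\<not> failed \<sigma>'" "\<not> forged \<sigma>'"
    using breach breach' by (auto simp: breach_def)
  have tags: "tag P \<omega> k l q x = tag P \<omega>' k l q x"
    if "k \<in> honest P C" "l \<in> recipients P q"
      "(q, x) \<in> sent (parties \<sigma> k)" "(q, x) \<in> sent (parties \<sigma>' k)" for k l q x
  proof (cases "l \<in> C")
    case False
    then have "l \<in> honest P C"
      using that recipients_subset by auto
    moreover have "cover P \<sigma> m k l q = x" "cover P \<sigma>' m' k l q = x"
      using that consistent_run[OF proper(1), of C A kn N] consistent_run[OF proper(2), of C A kn' N']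
      unfolding \<sigma> by (auto intro: cover_sent)
    ultimately show ?thesis
      using fun_cong[OF masked, of "(k, l, q)"] that(1) by (simp add: masked_def)
  qed (simp add: known)
  have eq: "run P \<omega> C A kn n = run P \<omega>' C A kn n" if "n \<le> N" "n \<le> N'" for n
  proof (rule run_eq_if_tags_agree[OF proper pw])
    show "tag P \<omega> k l q x = tag P \<omega>' k l q x" if "k \<in> C" for k l q x
      using that known by blast
    show "tag P \<omega> k l q x = tag P \<omega>' k l q x"
      if "k \<in> honest P C" "l \<in> recipients P q" "(q, x) \<in> sent (parties (run P \<omega> C A kn N) k)"
        "(q, x) \<in> sent (parties (run P \<omega>' C A kn N') k)" for k l q x
      using that tags[of k l q x] unfolding \<sigma> kn_eq by blast
  qed (use that live \<sigma> in auto)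
  \<comment> \<open>An attempt that breaches under \<phi> need not verify under \<psi>; either
    outcome raises a flag.\<close>
  have ends: "failed (run P \<psi> C A kn (Suc n)) \<or> forged (run P \<psi> C A kn (Suc n))"
    if "run P \<psi> C A kn n = \<rho>" "breach P \<phi> C \<rho> (A kn (hist \<rho>)) k l q x" for \<psi> \<phi> \<rho> n k l q x
    using that attempt_ends_run[of \<rho> k P C l q x _ \<psi>] by (auto simp: breach_def Let_def)
  have "N = N'"
  proof (rule linorder_cases[of N N'])
    assume "N < N'"
    then have "run P \<omega>' C A kn N = \<sigma>"
      using eq[of N] \<sigma> by simp
    from ends[OF this breach] have "failed \<sigma>' \<or> forged \<sigma>'"
      using run_mono(2,3)[of "Suc N" N' P \<omega>' C A kn] \<open>N < N'\<close> unfolding \<sigma> kn_eq by (meson Suc_leI)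
    with live show ?thesis
      by blast
  next
    assume "N' < N"
    then have "run P \<omega> C A kn N' = \<sigma>'"
      using eq[of N'] \<sigma> kn_eq by simp
    from ends[OF this breach'[unfolded kn_eq]] have "failed \<sigma> \<or> forged \<sigma>"
      using run_mono(2,3)[of "Suc N'" N P \<omega> C A kn] \<open>N' < N\<close> unfolding \<sigma> by (meson Suc_leI)
    with live show ?thesis
      by blast
  qed
  then have "\<sigma> = \<sigma>'"
    using eq[of N] \<sigma> kn_eq by simp
  moreover have "A kn (hist \<sigma>) = Deliver (Packet i j s m (tag P \<omega> i j s m))"
    using breach unfolding breach_def by (rule conjunct1)
  moreover have "A kn (hist \<sigma>') = Deliver (Packet i' j' s' m' (tag P \<omega>' i' j' s' m'))"
    using breach' unfolding breach_def kn_eq by (rule conjunct1)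
  ultimately show ?thesis
    by auto
qed

lemma AXU2_lengths:
  assumes "AXU2 \<epsilon> K f (strings (length m)) n" and "k \<in> K"
  shows "length (f k m) = n"
  using assms by (auto simp: AXU2_def hash_family_def strings_def)

lemma length_tag:
  assumes "\<And>b. AXU2 (\<epsilon> b) (axu_keys P) (axu P) (strings b) (tag_len P)"
    and "proper_secrets P \<omega>" and "i \<in> receivers P" and "j \<in> receivers P"
  shows "length (axu P (hkey \<omega> {i, j}) m) = tag_len P" and "length (tag P \<omega> i j s m) = tag_len P"
proof -
  show *: "length (axu P (hkey \<omega> {i, j}) m) = tag_len P"
    using assms(2-4) by (intro AXU2_lengths[OF assms(1)]) (auto simp: proper_secrets_def)
  then show "length (tag P \<omega> i j s m) = tag_len P"
    using assms(2-4) by (simp add: tag_def proper_secrets_def)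
qed

section \<open>Pads and user pairs as finite spaces\<close>

lemma finite_slots [simp]: "finite (UNIV :: slot set)"
proof -
  have e: "e \<in> {DocSig, RecKey}" for e
    by (cases e) auto
  have k: "k \<in> {SEND, ECHO, READY}" for k
    by (cases k) auto
  have "(UNIV :: slot set) \<subseteq> insert Share ((\<lambda>(e, k). Brb e k) ` ({DocSig, RecKey} \<times> {SEND, ECHO, READY}))"
  proof
    fix s
    show "s \<in> insert Share ((\<lambda>(e, k). Brb e k) ` ({DocSig, RecKey} \<times> {SEND, ECHO, READY}))"
      using e k by (cases s) auto
  qed
  then show ?thesis
    by (rule finite_subset) simp
qed

lemma finite_strings [simp]: "finite (strings n)"
  using finite_lists_length_eq[of "UNIV :: bool set" n] by (simp add: strings_def)

lemma strings_nonempty [simp]: "strings n \<noteq> {}"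
  using length_replicate[of n True] unfolding strings_def by blast

lemma in_strings_iff: "x \<in> strings n \<longleftrightarrow> length x = n"
  by (simp add: strings_def)

text \<open>The product of the pad distributions is uniform on this explicit finite set, as the
  counting argument for the change of variables requires.\<close>

definition pads :: "'k ers \<Rightarrow> (nat \<times> nat \<times> slot \<Rightarrow> bits) set" where
  "pads P = PiE_dflt (receivers P \<times> receivers P \<times> UNIV) [] (\<lambda>_. strings (tag_len P))"

definition user_pairs :: "'k ers \<Rightarrow> nat set set" where
  "user_pairs P = {{i, j} |i j. i \<in> receivers P \<and> j \<in> receivers P}"

lemma finite_user_pairs: "finite (user_pairs P)"
proof -
  have "user_pairs P = (\<lambda>(i, j). {i, j}) ` (receivers P \<times> receivers P)"
    by (auto simp: user_pairs_def)
  then show ?thesis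
    by (simp add: receivers_def)
qed

lemma pads_simps:
  "finite (pads P)" "pads P \<noteq> {}"
  "Pi_pmf (receivers P \<times> receivers P \<times> UNIV) [] (\<lambda>_. pmf_of_set (strings (tag_len P))) = pmf_of_set (pads P)"
proof -
  have fin: "finite (receivers P \<times> receivers P \<times> (UNIV :: slot set))"
    by (simp add: receivers_def)
  show "finite (pads P)"
    unfolding pads_def using fin by (rule finite_PiE_dflt) simp
  show "Pi_pmf (receivers P \<times> receivers P \<times> UNIV) [] (\<lambda>_. pmf_of_set (strings (tag_len P))) = pmf_of_set (pads P)"
    unfolding pads_def using fin by (rule Pi_pmf_of_set) simp_all
  have "(\<lambda>x. if x \<in> receivers P \<times> receivers P \<times> UNIV then replicate (tag_len P) True else []) \<in> pads P"
    by (auto simp: pads_def PiE_dflt_def strings_def)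
  then show "pads P \<noteq> {}"
    by blast
qed

text \<open>Pairwise keys and the picked string are held fixed, which treats an honest and a
  colluding sender alike; only hash keys and pads remain random. The pads are exchanged for their
  \<open>masked\<close> image, and then the hash keys of the pairs meeting C are fixed as
  well.\<close>

lemma prob_breach:
  fixes P :: "'k ers"
  assumes doc: "0 < doc_len P"
    and axu: "\<And>b. AXU2 (real b * 2 powr (1 - real (tag_len P))) (axu_keys P) (axu P) (strings b) (tag_len P)"
    and X: "\<And>k. k \<in> receivers P \<Longrightarrow> length (X k) = key_len P"
    and secrets: "\<And>f d. S f d = \<lparr>pairwise = X, pick = h, hkey = f, pad = d\<rparr>"
    and bound: "\<And>s. real (slot_len P s) * 2 powr (1 - real (tag_len P)) \<le> \<epsilon>"
    and F: "F = Pi_pmf (user_pairs P) undefined (\<lambda>_. pmf_of_set (axu_keys P))"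
    and \<Sigma>: "\<And>f d n. \<Sigma> f d n = run P (S f d) C A (knowledge P (S f d) C b doc) n"
    and a: "\<And>f d n. a f d n = A (knowledge P (S f d) C b doc) (hist (\<Sigma> f d n))"
  shows "measure_pmf.prob (pair_pmf F (pmf_of_set (pads P)))
           {(f, d). \<exists>n i j s m. breach P (S f d) C (\<Sigma> f d n) (a f d n) i j s m} \<le> \<epsilon>"
proof -
  \<comment> \<open>The support conditions are part of the relation because injectivity and the
    bound are demanded for all related values.\<close>
  define \<Psi> where "\<Psi> f d u \<longleftrightarrow> f \<in> set_pmf F \<and> d \<in> pads P \<and>
    (\<exists>n i j s m. breach P (S f d) C (\<Sigma> f d n) (a f d n) i j s m \<and>
       u = masked P (S f d) C (\<Sigma> f d n) m)" for f d u
  have keys: "finite (axu_keys P)" "axu_keys P \<noteq> {}"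
    using axu by (auto simp: AXU2_def hash_family_def)
  have setF: "set_pmf F = PiE_dflt (user_pairs P) undefined (\<lambda>_. axu_keys P)"
    using keys by (simp add: F set_Pi_pmf finite_user_pairs o_def)
  have \<epsilon>: "0 \<le> \<epsilon>"
    using bound[of Share] by (rule order_trans[rotated]) simp
  have proper: "proper_secrets P (S f d)" if "f \<in> set_pmf F" "d \<in> pads P" for f d
    using that X unfolding setF pads_def proper_secrets_def secrets PiE_dflt_def
    by (auto simp: strings_def user_pairs_def)
  have cons: "consistent P (S f d) C (\<Sigma> f d n)" if "f \<in> set_pmf F" "d \<in> pads P" for f d n
    unfolding \<Sigma> by (rule consistent_run[OF proper[OF that]])
  note len = length_tag[OF axu]
  have coincide: "\<Sigma> f d n = \<Sigma> f' d' n' \<and> i = i' \<and> j = j' \<and> s = s' \<and> m = m' \<and>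
      tag P (S f d) i j s m = tag P (S f' d') i j s m"
    if "f \<in> set_pmf F" "d \<in> pads P" "f' \<in> set_pmf F" "d' \<in> pads P"
      "\<And>U. U \<inter> C \<noteq> {} \<Longrightarrow> f U = f' U"
      "breach P (S f d) C (\<Sigma> f d n) (a f d n) i j s m"
      "breach P (S f' d') C (\<Sigma> f' d' n') (a f' d' n') i' j' s' m'"
      "masked P (S f d) C (\<Sigma> f d n) m = masked P (S f' d') C (\<Sigma> f' d' n') m'"
    for f d f' d' n n' i j s m i' j' s' m'
    by (rule breach_unique[OF proper[OF that(1,2)] proper[OF that(3,4)] _ _ _ refl refl \<Sigma> \<Sigma>
          that(6)[unfolded a] that(7)[unfolded a] that(8)]) (simp_all add: secrets that(5))
  show ?thesis
  proof (rule prob_pair_pmf_of_set_le[OF pads_simps(1,2) \<epsilon>, where \<Psi> = \<Psi>])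
    fix f d
    assume f: "f \<in> set_pmf F" and d: "d \<in> pads P"
      and "(f, d) \<in> {(f, d). \<exists>n i j s m. breach P (S f d) C (\<Sigma> f d n) (a f d n) i j s m}"
    then obtain n i j s m where br: "breach P (S f d) C (\<Sigma> f d n) (a f d n) i j s m"
      by blast
    have "masked P (S f d) C (\<Sigma> f d n) m \<in> pads P"
      using d len(2)[OF proper[OF f d]]
      by (auto simp: pads_def PiE_dflt_def masked_def strings_def secrets)
    then show "\<exists>u\<in>pads P. \<Psi> f d u"
      using f d br unfolding \<Psi>_def by blast
  next
    fix f d d' u
    assume "\<Psi> f d u" "\<Psi> f d' u"
    then obtain n i j s m n' i' j' s' m' where f: "f \<in> set_pmf F" and d: "d \<in> pads P" "d' \<in> pads P"
      and br: "breach P (S f d) C (\<Sigma> f d n) (a f d n) i j s m"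
        "breach P (S f d') C (\<Sigma> f d' n') (a f d' n') i' j' s' m'"
      and u: "u = masked P (S f d) C (\<Sigma> f d n) m" "u = masked P (S f d') C (\<Sigma> f d' n') m'"
      unfolding \<Psi>_def by blast
    have eq: "\<Sigma> f d' n' = \<Sigma> f d n" "m' = m"
      using coincide[OF f d(1) f d(2) refl br] u by auto
    show "d = d'"
    proof
      fix x :: "nat \<times> nat \<times> slot"
      obtain k l q where x: "x = (k, l, q)"
        by (cases x)
      show "d x = d' x"
      proof (cases "k \<in> honest P C \<and> l \<in> honest P C")
        case True
        let ?c = "cover P (\<Sigma> f d n) m k l q"
        \<comment> \<open>Equal states and forged strings give the same covering string, and f is
          common to both, so equal tags leave equal pads.\<close>
        have "tag P (S f d) k l q ?c = tag P (S f d') k l q ?c"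
          using fun_cong[OF u(1), of x] fun_cong[OF u(2), of x] True eq by (simp add: x masked_def)
        moreover have "length (axu P (f {k, l}) ?c) = tag_len P"
          using len(1)[OF proper[OF f d(1)], of k l] True by (simp add: secrets)
        moreover have "length (d x) = tag_len P" "length (d' x) = tag_len P"
          using proper[OF f d(1)] proper[OF f d(2)] True by (auto simp: proper_secrets_def secrets x)
        ultimately show ?thesis
          by (simp add: tag_def secrets x bxor_cancel_left)
      next
        case False
        then show ?thesis
          using fun_cong[OF u(1), of x] fun_cong[OF u(2), of x] by (auto simp: x masked_def secrets)
      qed
    qed
  next
    fix u
    let ?E = "{f. \<exists>d. \<Psi> f d u}"
    show "measure_pmf.prob F ?E \<le> \<epsilon>"
      unfolding F
    proof (rule prob_Pi_pmf_le_component[where B = "{U \<in> user_pairs P. U \<inter> C \<noteq> {}}"])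
      fix f
      assume "f \<in> ?E"
      then obtain d n i j s m where f: "f \<in> set_pmf F" and d: "d \<in> pads P"
        and br: "breach P (S f d) C (\<Sigma> f d n) (a f d n) i j s m"
        and u: "u = masked P (S f d) C (\<Sigma> f d n) m"
        unfolding \<Psi>_def by blast
      have ij: "i \<in> honest P C" "j \<in> honest P C" and m: "length m = slot_len P s"
        using br by (auto simp: breach_def active_def)
      let ?c = "cover P (\<Sigma> f d n) m i j s"
      let ?t = "tag P (S f d) i j s m"
      \<comment> \<open>Both tags use the pad of (i, j, s), which cancels in their XOR. By
        \<open>coincide\<close>, neither m, the covering string nor the two tags depend on the keys
        of pairs avoiding C.\<close>
      define K where "K = {k. bxor (axu P k m) (axu P k ?c) = bxor ?t (u (i, j, s))}"
      have mem: "f' {i, j} \<in> K"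
        if f': "f' \<in> ?E" and agree: "\<forall>U\<in>{U \<in> user_pairs P. U \<inter> C \<noteq> {}}. f' U = f U" for f'
      proof -
        from f' obtain d' n' i' j' s' m' where f': "f' \<in> set_pmf F" and d': "d' \<in> pads P"
          and br': "breach P (S f' d') C (\<Sigma> f' d' n') (a f' d' n') i' j' s' m'"
          and u': "u = masked P (S f' d') C (\<Sigma> f' d' n') m'"
          unfolding \<Psi>_def by blast
        \<comment> \<open>Outside \<open>user_pairs\<close> both functions take the default value
          \<open>undefined\<close>.\<close>
        have "f U = f' U" if "U \<inter> C \<noteq> {}" for U
          using agree that f f' unfolding setF PiE_dflt_def by (cases "U \<in> user_pairs P") auto
        from coincide[OF f d f' d' this br br'] u u'
        have eq: "\<Sigma> f' d' n' = \<Sigma> f d n" "m' = m" "?t = tag P (S f' d') i j s m"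
          by auto
        have "u (i, j, s) = tag P (S f' d') i j s ?c"
          using ij unfolding u' eq by (simp add: masked_def)
        moreover have "length (axu P (f' {i, j}) x) = tag_len P" for x
          using len(1)[OF proper[OF f' d'], of i j] ij by (simp add: secrets)
        moreover have "length (d' (i, j, s)) = tag_len P"
          using proper[OF f' d'] ij by (simp add: proper_secrets_def secrets)
        ultimately show ?thesis
          unfolding K_def mem_Collect_eq eq(3) by (simp add: tag_def secrets bxor_bxor_cancel)
      qed
      have "?c \<noteq> m"
        by (rule cover_breach[OF cons[OF f d] doc br])
      moreover have "length ?c = slot_len P s"
        by (rule length_cover[OF cons[OF f d] doc])
      moreover have "bxor ?t (u (i, j, s)) \<in> strings (tag_len P)"
        using len(2)[OF proper[OF f d], of i j] ij by (simp add: u masked_def strings_def)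
      ultimately have "measure_pmf.prob (pmf_of_set (axu_keys P)) K
          \<le> real (slot_len P s) * 2 powr (1 - real (tag_len P))"
        using axu[of "slot_len P s"] m unfolding AXU2_def K_def by (auto simp: strings_def)
      also have "\<dots> \<le> \<epsilon>"
        by (rule bound)
      finally have "measure_pmf.prob (pmf_of_set (axu_keys P)) K \<le> \<epsilon>" .
      moreover have "{i, j} \<in> user_pairs P - {U \<in> user_pairs P. U \<inter> C \<noteq> {}}"
        using ij by (auto simp: user_pairs_def)
      ultimately show "\<exists>U\<in>user_pairs P - {U \<in> user_pairs P. U \<inter> C \<noteq> {}}. \<exists>K.
          measure_pmf.prob (pmf_of_set (axu_keys P)) K \<le> \<epsilon> \<and>
          (\<forall>f'\<in>?E. (\<forall>U\<in>{U \<in> user_pairs P. U \<inter> C \<noteq> {}}. f' U = f U) \<longrightarrow> f' U \<in> K)"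
        using mem by blast
    qed (use finite_user_pairs \<epsilon> in auto)
  qed
qed

section \<open>Assembling the bound\<close>

lemma proper_secrets_pmf:
  assumes "finite (axu_keys P)" and "axu_keys P \<noteq> {}" and "\<omega> \<in> set_pmf (secrets_pmf P)"
  shows "proper_secrets P \<omega>"
proof -
  have fin: "finite (receivers P)"
    by (simp add: receivers_def)
  obtain X h f d where \<omega>: "\<omega> = \<lparr>pairwise = X, pick = h, hkey = f, pad = d\<rparr>"
    and X: "X \<in> set_pmf (Pi_pmf (receivers P) [] (\<lambda>_. pmf_of_set (strings (key_len P))))"
    and f: "f \<in> set_pmf (Pi_pmf (user_pairs P) undefined (\<lambda>_. pmf_of_set (axu_keys P)))"
    and d: "d \<in> set_pmf (pmf_of_set (pads P))"
    using assms(3) unfolding secrets_pmf_def user_pairs_def[symmetric] pads_simps by auto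
  have "length (X k) = key_len P" if "k \<in> receivers P" for k
    using X that fin by (auto simp: set_Pi_pmf PiE_dflt_def in_strings_iff)
  moreover have "f {i, j} \<in> axu_keys P" if "i \<in> receivers P" "j \<in> receivers P" for i j
  proof -
    have "{i, j} \<in> user_pairs P"
      using that by (auto simp: user_pairs_def)
    then show ?thesis
      using f assms(1,2) by (auto simp: set_Pi_pmf finite_user_pairs PiE_dflt_def)
  qed
  moreover have "length (d (i, j, s)) = tag_len P" if "i \<in> receivers P" "j \<in> receivers P" for i j s
  proof -
    have "d \<in> pads P"
      using d pads_simps(1,2)[of P] by simp
    then show ?thesis
      using that by (auto simp: pads_def PiE_dflt_def in_strings_iff)
  qed
  ultimately show ?thesis
    by (simp add: proper_secrets_def \<omega>)
qed

text \<open>The pair of document and signature is the longest content that is ever hashed, whence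
  the numerator of the bound.\<close>

lemma slot_len_le: "slot_len P s \<le> doc_len P + hash_len P + key_len P"
proof (cases s)
  case (Brb e k)
  then show ?thesis
    by (cases e) auto
qed simp

theorem mainTheorem1:
  fixes P :: "'k ers" and C :: "nat set"
    and colluding :: bool and doc :: bits
    and R :: "'r pmf" and A :: "('r, 'k) strategy" and T :: nat
  assumes "0 < doc_len P"
    and "ASU2 (2 powr (1 - real (hash_len P))) (strings (key_len P)) (asu P)
           (strings (doc_len P)) (hash_len P)"
    and "\<And>b. AXU2 (real b * 2 powr (1 - real (tag_len P))) (axu_keys P) (axu P)
           (strings b) (tag_len P)"
    and "real (flt P) < real (rcvs P) / 3"
    and "C \<subseteq> receivers P" and "card C \<le> flt P"
    and "doc \<in> strings (doc_len P)"
    and "timeouts_ok P C (execution P C colluding doc R A T)"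
  shows "measure_pmf.prob (execution P C colluding doc R A T) {\<sigma>. repudiated P C \<sigma>}
           \<le> real (doc_len P + hash_len P + key_len P) / 2 powr (real (tag_len P) - 1)"
proof -
  let ?\<epsilon> = "real (doc_len P + hash_len P + key_len P) / 2 powr (real (tag_len P) - 1)"
  define \<Sigma> where "\<Sigma> r \<omega> n = run P \<omega> C (A r) (knowledge P \<omega> C colluding doc) n" for r \<omega> n
  define B where "B r \<omega> \<longleftrightarrow> (\<exists>n i j s m. breach P \<omega> C (\<Sigma> r \<omega> n)
    (A r (knowledge P \<omega> C colluding doc) (hist (\<Sigma> r \<omega> n))) i j s m)" for r \<omega>
  have keys: "finite (axu_keys P)" "axu_keys P \<noteq> {}"
    using assms(3) by (auto simp: AXU2_def hash_family_def)
  have C: "finite C"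
    using assms(5) by (rule finite_subset) (simp add: receivers_def)
  have bound: "real (slot_len P s) * 2 powr (1 - real (tag_len P)) \<le> ?\<epsilon>" for s
  proof -
    have "2 powr (1 - real (tag_len P)) = inverse (2 powr (real (tag_len P) - 1))"
      by (simp add: powr_minus[symmetric])
    then show ?thesis
      using slot_len_le[of P s] by (simp add: field_simps)
  qed
  have "measure_pmf.prob (execution P C colluding doc R A T) {\<sigma>. repudiated P C \<sigma>} =
      measure_pmf.prob (pair_pmf (secrets_pmf P) R) {(\<omega>, r). repudiated P C (\<Sigma> r \<omega> T)}"
    by (auto simp: execution_def \<Sigma>_def intro!: arg_cong[where f = "measure_pmf.prob _"])
  also have "\<dots> \<le> measure_pmf.prob (pair_pmf (secrets_pmf P) R) {(\<omega>, r). B r \<omega>}"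
  proof (rule measure_pmf.finite_measure_mono_AE)
    have "B r \<omega>" if \<omega>: "\<omega> \<in> set_pmf (secrets_pmf P)" and r: "r \<in> set_pmf R"
      and rep: "repudiated P C (\<Sigma> r \<omega> T)" for \<omega> r
    proof -
      \<comment> \<open>A failed run gives \<open>VAbort\<close> to everyone, so differing verdicts
        exclude it.\<close>
      have live: "\<not> failed (\<Sigma> r \<omega> T)"
        using rep by (auto simp: repudiated_def verdict_def)
      have "\<Sigma> r \<omega> T \<in> set_pmf (execution P C colluding doc R A T)"
        using \<omega> r by (force simp: execution_def \<Sigma>_def)
      then have "forged (\<Sigma> r \<omega> T)"
        using assms(8) rep live not_repudiated[OF proper_secrets_pmf[OF keys \<omega>] C assms(6) \<Sigma>_def]
        unfolding timeouts_ok_def by blast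
      then show ?thesis
        using forged_imp_breach live unfolding B_def \<Sigma>_def by blast
    qed
    then show "AE x in pair_pmf (secrets_pmf P) R.
        x \<in> {(\<omega>, r). repudiated P C (\<Sigma> r \<omega> T)} \<longrightarrow> x \<in> {(\<omega>, r). B r \<omega>}"
      by (auto simp: AE_measure_pmf_iff)
  qed simp
  also have "\<dots> \<le> ?\<epsilon>"
  proof (rule prob_pair_pmf_le')
    fix r
    let ?F = "Pi_pmf (user_pairs P) undefined (\<lambda>_. pmf_of_set (axu_keys P))"
    have fixed_keys: "measure_pmf.prob (pair_pmf ?F (pmf_of_set (pads P)))
        {(f, d). B r \<lparr>pairwise = X, pick = h, hkey = f, pad = d\<rparr>} \<le> ?\<epsilon>"
      if "X \<in> set_pmf (Pi_pmf (receivers P) [] (\<lambda>_. pmf_of_set (strings (key_len P))))" for X h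
    proof -
      have "length (X k) = key_len P" if "k \<in> receivers P" for k
        using \<open>X \<in> _\<close> that by (auto simp: set_Pi_pmf receivers_def PiE_dflt_def in_strings_iff)
      then show ?thesis
        unfolding B_def by (rule prob_breach[OF assms(1,3) _ refl bound refl \<Sigma>_def refl])
    qed
    \<comment> \<open>With the coins r fixed, two conditionings peel off the pairwise keys and the
      picked string.\<close>
    have "measure_pmf.prob (secrets_pmf P) {\<omega>. B r \<omega>} \<le> ?\<epsilon>"
      unfolding secrets_pmf_def user_pairs_def[symmetric] pads_simps measure_map_pmf
      by (rule prob_pair_pmf_le, rule prob_pair_pmf_le)
        (use fixed_keys in \<open>simp_all add: vimage_def case_prod_unfold\<close>)
    then show "measure_pmf.prob (secrets_pmf P) {\<omega>. (\<omega>, r) \<in> {(\<omega>, r). B r \<omega>}} \<le> ?\<epsilon>"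
      by simp
  qed simp
  finally show ?thesis .
qed

end
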